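(* Let $K$ be a compact metric space, $f$ a complex-valued function on $K$, and $(f_n)$ a uniformly bounded sequence of complex-valued continuous functions on $K$ with $f_n\to f$ pointwise. If $f$ is not in $D(K)$, then $(f_n)$ has an (s.s.) subsequence (as a sequence in the Banach space $C(K)$ of continuous complex-valued functions on $K$ with the supremum norm).
   Context: $D(K)$ is the set of all functions $f:K\to\mathbb C$ for which there exist continuous complex-valued functions $\varphi_1,\varphi_2,\dots$ on $K$ with $\sup_{k\in K}\sum_j|\varphi_j(k)|<\infty$ and $f=\sum_j\varphi_j$ pointwise. A basic sequence is a sequence in a Banach space that is a Schauder basis of its closed linear span. A sequence $(b_j)$ in a Banach space is strongly summing (s.s.) if it is a basic sequence which is weak-Cauchy ($\lim_j b^*(b_j)$ exists for every $b^*$ in the dual) and such that whenever scalars $(c_j)$ satisfy $\sup_n\|\sum_{j=1}^n c_jb_j\|<\infty$, the series $\sum c_j$ converges. *)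

theory Defs
  imports "HOL-Analysis.Analysis"
begin

text \<open>
  The library has only real normed spaces. Span, dual space and basis expansions are taken over the
  complex scalars here, so a complex scalar multiplication that is compatible with the real
  structure and the norm is added as a type class.
\<close>

class scaleC =
  fixes scaleC :: "complex \<Rightarrow> 'a \<Rightarrow> 'a"  (infixr "*\<^sub>C" 75)

class complex_vector = real_vector + scaleC +
  assumes scaleC_add_right: "a *\<^sub>C (x + y) = a *\<^sub>C x + a *\<^sub>C y"
    and scaleC_add_left: "(a + b) *\<^sub>C x = a *\<^sub>C x + b *\<^sub>C x"
    and scaleC_scaleC: "a *\<^sub>C b *\<^sub>C x = (a * b) *\<^sub>C x"
    and scaleC_one: "1 *\<^sub>C x = x"
    and scaleR_scaleC: "r *\<^sub>R x = complex_of_real r *\<^sub>C x"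

class complex_normed_vector = complex_vector + real_normed_vector +
  assumes norm_scaleC: "norm (a *\<^sub>C x) = cmod a * norm x"

class complex_banach = complex_normed_vector + banach

global_interpretation complex_vector:
  vector_space "scaleC :: complex \<Rightarrow> 'a \<Rightarrow> 'a::complex_vector"
  by unfold_locales (simp_all add: scaleC_add_right scaleC_add_left scaleC_scaleC scaleC_one)

instantiation complex :: complex_banach
begin

definition scaleC_complex :: "complex \<Rightarrow> complex \<Rightarrow> complex"
  where [simp]: "scaleC_complex = (*)"

instance
  by standard (simp_all add: algebra_simps norm_mult scaleR_conv_of_real)

end

lemma scaleC_mem_bcontfun:
  fixes f :: "'a::topological_space \<Rightarrow> 'b::complex_normed_vector"
  assumes "f \<in> bcontfun"
  shows "(\<lambda>x. a *\<^sub>C f x) \<in> bcontfun"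
proof -
  have "bounded_linear (\<lambda>x::'b. a *\<^sub>C x)"
    by (rule bounded_linear_intro[where K = "cmod a"])
       (simp_all add: scaleC_add_right scaleR_scaleC scaleC_scaleC norm_scaleC mult.commute)
  then show ?thesis
    using assms
    by (auto simp: bcontfun_def image_image[symmetric]
        intro: bounded_linear.continuous_on bounded_linear_image)
qed

instantiation bcontfun :: (topological_space, complex_normed_vector) complex_normed_vector
begin

definition scaleC_bcontfun :: "complex \<Rightarrow> ('a \<Rightarrow>\<^sub>C 'b) \<Rightarrow> ('a \<Rightarrow>\<^sub>C 'b)"
  where "scaleC_bcontfun a f = Bcontfun (\<lambda>x. a *\<^sub>C apply_bcontfun f x)"

lemma apply_bcontfun_scaleC [simp]:
  "apply_bcontfun (a *\<^sub>C f) x = a *\<^sub>C apply_bcontfun f x"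
  by (simp add: scaleC_bcontfun_def Bcontfun_inverse scaleC_mem_bcontfun apply_bcontfun)

instance
proof
  fix a b :: complex and r :: real and f g :: "'a \<Rightarrow>\<^sub>C 'b"
  show "a *\<^sub>C (f + g) = a *\<^sub>C f + a *\<^sub>C g"
    by (rule bcontfun_eqI) (simp add: scaleC_add_right)
  show "(a + b) *\<^sub>C f = a *\<^sub>C f + b *\<^sub>C f"
    by (rule bcontfun_eqI) (simp add: scaleC_add_left)
  show "a *\<^sub>C b *\<^sub>C f = (a * b) *\<^sub>C f"
    by (rule bcontfun_eqI) (simp add: scaleC_scaleC)
  show "1 *\<^sub>C f = f"
    by (rule bcontfun_eqI) (simp add: scaleC_one)
  show "r *\<^sub>R f = complex_of_real r *\<^sub>C f"
    by (rule bcontfun_eqI) (simp add: scaleR_scaleC)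
  have le: "norm (c *\<^sub>C h) \<le> cmod c * norm h" for c and h :: "'a \<Rightarrow>\<^sub>C 'b"
    by (rule norm_bound) (simp add: norm_scaleC mult_left_mono norm_bounded)
  show "norm (a *\<^sub>C f) = cmod a * norm f"
  proof (cases "a = 0")
    case True
    then show ?thesis using le[of a f] by simp
  next
    case False
    have "norm (inverse a *\<^sub>C a *\<^sub>C f) \<le> cmod (inverse a) * norm (a *\<^sub>C f)"
      by (rule le)
    moreover have "inverse a *\<^sub>C a *\<^sub>C f = f"
      by (rule bcontfun_eqI) (simp add: False scaleC_scaleC scaleC_one)
    ultimately have "norm f \<le> inverse (cmod a) * norm (a *\<^sub>C f)"
      by (simp only: norm_inverse)
    then have "cmod a * norm f \<le> cmod a * (inverse (cmod a) * norm (a *\<^sub>C f))"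
      by (rule mult_left_mono) simp
    then have "cmod a * norm f \<le> norm (a *\<^sub>C f)"
      using False by (simp only: mult.assoc[symmetric]) simp
    then show ?thesis using le[of a f] by simp
  qed
qed

end

instance bcontfun :: (metric_space, complex_banach) complex_banach ..

definition bounded_clinear_functional :: "('b::complex_normed_vector \<Rightarrow> complex) \<Rightarrow> bool"
  where "bounded_clinear_functional \<phi> \<longleftrightarrow>
    bounded_linear \<phi> \<and> (\<forall>c x. \<phi> (c *\<^sub>C x) = c * \<phi> x)"

definition schauder_basis_of :: "'b::complex_banach set \<Rightarrow> (nat \<Rightarrow> 'b) \<Rightarrow> bool"
  where "schauder_basis_of X b \<longleftrightarrow>
    range b \<subseteq> X \<and> (\<forall>x\<in>X. \<exists>!c :: nat \<Rightarrow> complex. (\<lambda>j. c j *\<^sub>C b j) sums x)"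

definition basic_sequence :: "(nat \<Rightarrow> 'b::complex_banach) \<Rightarrow> bool"
  where "basic_sequence b \<longleftrightarrow>
    schauder_basis_of (closure (complex_vector.span (range b))) b"

definition weak_Cauchy :: "(nat \<Rightarrow> 'b::complex_banach) \<Rightarrow> bool"
  where "weak_Cauchy b \<longleftrightarrow>
    (\<forall>\<phi>. bounded_clinear_functional \<phi> \<longrightarrow> convergent (\<lambda>j. \<phi> (b j)))"

definition strongly_summing :: "(nat \<Rightarrow> 'b::complex_banach) \<Rightarrow> bool"
  where "strongly_summing b \<longleftrightarrow>
    basic_sequence b \<and> weak_Cauchy b \<and>
    (\<forall>c :: nat \<Rightarrow> complex.
      bdd_above (range (\<lambda>n. norm (\<Sum>j<n. c j *\<^sub>C b j))) \<longrightarrow> summable c)"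

text \<open>
  The space \<open>K\<close> is the whole type; when it is compact, every continuous function is bounded, so
  that \<^typ>\<open>'a \<Rightarrow>\<^sub>C complex\<close> is the Banach space \<open>C(K)\<close>. Summability
  of the moduli is required explicitly because \<^const>\<open>suminf\<close> carries no information about a divergent series.
\<close>

definition D_class :: "('a::topological_space \<Rightarrow> complex) set"
  where "D_class = {f. \<exists>\<phi> :: nat \<Rightarrow> 'a \<Rightarrow> complex.
    (\<forall>j. continuous_on UNIV (\<phi> j)) \<and>
    (\<exists>M. \<forall>k. summable (\<lambda>j. cmod (\<phi> j k)) \<and> (\<Sum>j. cmod (\<phi> j k)) \<le> M) \<and>
    (\<forall>k. (\<lambda>j. \<phi> j k) sums f k)}"

end

theory Submission
  imports Defs
begin

text \<open>
  Consider a game on \<open>K\<close> for a real function \<open>g\<close>: from the current point the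
  opponent names a neighbourhood and the player moves inside it; the player decides in advance,
  at each point, whether the increment of \<open>g\<close> at the next move is to be counted. If
  the guaranteed total gain is bounded, its supremum \<open>w\<close> satisfies that \<open>w\<close> and
  \<open>w + g\<close> are upper semicontinuous, so \<open>g = (w + g) - w\<close> is in \<open>D(K)\<close>.
  Hence for \<open>f\<close> outside \<open>D(K)\<close>, for \<open>g\<close> the real or the imaginary part
  of \<open>f\<close>, there are winning strategies with arbitrarily large gain, and they use only
  countably many points of \<open>K\<close>.

  If \<open>b\<^sub>j\<close> is a sufficiently sparse subsequence, the game can be played along it: while the
  player waits at a point, \<open>b\<^sub>j\<close> is already close to \<open>f\<close> there, and moving after step
  \<open>j\<close> barely changes \<open>b\<^sub>0, \<dots>, b\<^sub>j\<close>. Suppose that the partial sums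
  \<open>s\<^sub>j\<close> of \<open>c\<close> are bounded and have two cluster points, normalised to 0 and 1.
  Moving only when \<open>s\<^sub>j\<close> is close to 1 (counted moves) or to 0 (moves that are not counted)
  makes \<open>\<Sum> s\<^sub>j (b\<^sub>j\<^sub>+\<^sub>1 - b\<^sub>j)\<close> at the final point as large as the gain; by Abel summation
  \<open>\<Sum> c\<^sub>j b\<^sub>j\<close> has unbounded partial sums. Boundedness of \<open>s\<^sub>j\<close> and basicness come from
  the positive distance of \<open>f\<close> to \<open>C(K)\<close> and finite norming sets for the spans of
  \<open>b\<^sub>0, \<dots>, b\<^sub>j, f\<close>.
\<close>

section \<open>Functions in \<open>D(K)\<close>\<close>

lemma D_class_continuous:
  assumes "continuous_on UNIV f" "\<And>x. cmod (f x) \<le> B"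
  shows "f \<in> D_class"
proof -
  have "(\<lambda>j::nat. if j = 0 then f x else 0) sums f x"
    and "(\<lambda>j::nat. cmod (if j = 0 then f x else 0)) sums cmod (f x)" for x
    using sums_finite[of "{0::nat}" "\<lambda>j. if j = 0 then f x else 0"]
      sums_finite[of "{0::nat}" "\<lambda>j. cmod (if j = 0 then f x else 0)"] by auto
  moreover have "continuous_on UNIV (\<lambda>x. if j = 0 then f x else 0)" for j :: nat
    using assms(1) by (cases "j = 0") simp_all
  ultimately show ?thesis using assms(2) unfolding D_class_def sums_iff
    by (intro CollectI exI[of _ "\<lambda>j x. if j = 0 then f x else 0"] conjI allI exI[of _ B]) simp_all
qed

lemma D_class_linear:
  assumes "f \<in> D_class" "g \<in> D_class"
  shows "(\<lambda>x. f x + a * g x) \<in> D_class"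
proof -
  obtain \<phi> M where \<phi>: "\<And>j. continuous_on UNIV (\<phi> j)" "\<And>k. (\<lambda>j. \<phi> j k) sums f k"
      "\<And>k. summable (\<lambda>j. cmod (\<phi> j k))" "\<And>k. (\<Sum>j. cmod (\<phi> j k)) \<le> M"
    using assms(1) unfolding D_class_def by blast
  obtain \<psi> N where \<psi>: "\<And>j. continuous_on UNIV (\<psi> j)" "\<And>k. (\<lambda>j. \<psi> j k) sums g k"
      "\<And>k. summable (\<lambda>j. cmod (\<psi> j k))" "\<And>k. (\<Sum>j. cmod (\<psi> j k)) \<le> N"
    using assms(2) unfolding D_class_def by blast
  have le: "norm (cmod (\<phi> j k + a * \<psi> j k)) \<le> cmod (\<phi> j k) + cmod a * cmod (\<psi> j k)" for j k
    by (simp add: norm_mult[symmetric] norm_triangle_ineq)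
  have s: "summable (\<lambda>j. cmod (\<phi> j k) + cmod a * cmod (\<psi> j k))" for k
    by (intro summable_add summable_mult \<phi> \<psi>)
  have s': "summable (\<lambda>j. cmod (\<phi> j k + a * \<psi> j k))" for k
    by (rule summable_comparison_test'[OF s[of k], of 0]) (rule le)
  have "(\<Sum>j. cmod (\<phi> j k + a * \<psi> j k)) \<le> M + cmod a * N" for k
  proof -
    have "(\<Sum>j. cmod (\<phi> j k + a * \<psi> j k)) \<le> (\<Sum>j. cmod (\<phi> j k) + cmod a * cmod (\<psi> j k))"
      using le s s' by (intro suminf_le) auto
    also have "\<dots> = (\<Sum>j. cmod (\<phi> j k)) + cmod a * (\<Sum>j. cmod (\<psi> j k))"
      by (simp add: \<phi>(3) \<psi>(3) suminf_add[symmetric] suminf_mult summable_mult)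
    also have "\<dots> \<le> M + cmod a * N"
      by (intro add_mono mult_left_mono \<phi> \<psi>) auto
    finally show ?thesis .
  qed
  with s' show ?thesis unfolding D_class_def
    by (intro CollectI exI[of _ "\<lambda>j x. \<phi> j x + a * \<psi> j x"] conjI allI exI[of _ "M + cmod a * N"]
        continuous_intros sums_add sums_mult \<phi> \<psi>) auto
qed

text \<open>After the first term all terms of the telescoping series
  \<open>h 0 + (h 1 - h 0) + ...\<close> are nonpositive, so its absolute series telescopes too, to
  \<open>h 0 - u + |h 0|\<close>, which is at most \<open>3 * B\<close>.\<close>

lemma D_class_decreasing_limit:
  fixes h :: "nat \<Rightarrow> 'a::topological_space \<Rightarrow> real"
  assumes cont: "\<And>n. continuous_on UNIV (h n)"
    and dec: "\<And>n x. h (Suc n) x \<le> h n x"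
    and bound: "\<And>n x. \<bar>h n x\<bar> \<le> B"
    and lim: "\<And>x. (\<lambda>n. h n x) \<longlonglongrightarrow> u x"
  shows "(\<lambda>x. complex_of_real (u x)) \<in> D_class"
proof -
  define \<phi> where "\<phi> = (\<lambda>j x. complex_of_real (case j of 0 \<Rightarrow> h 0 x | Suc i \<Rightarrow> h (Suc i) x - h i x))"
  have ub: "\<bar>u x\<bar> \<le> B" for x
    using bound by (intro LIMSEQ_le_const2[OF tendsto_rabs[OF lim]]) auto
  have c: "continuous_on UNIV (\<phi> j)" for j
    by (cases j) (auto simp: \<phi>_def intro!: continuous_intros cont)
  have "(\<lambda>n. h (Suc n) x - h n x) sums (u x - h 0 x)" for x
    by (rule telescope_sums[OF lim])
  then have "(\<lambda>n. \<phi> (Suc n) x) sums (complex_of_real (u x) - complex_of_real (h 0 x))" for x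
    unfolding \<phi>_def by (simp flip: of_real_diff add: sums_of_real_iff)
  then have 1: "(\<lambda>n. \<phi> n x) sums complex_of_real (u x)" for x
    using sums_Suc[of "\<lambda>n. \<phi> n x"] by (fastforce simp: \<phi>_def)
  have "(\<lambda>n. h n x - h (Suc n) x) sums (h 0 x - u x)" for x
    by (rule telescope_sums'[OF lim])
  moreover have "cmod (\<phi> (Suc n) x) = h n x - h (Suc n) x" for n x
    using dec[of n x] by (simp add: \<phi>_def flip: of_real_diff)
  ultimately have 2: "(\<lambda>n. cmod (\<phi> n x)) sums (h 0 x - u x + \<bar>h 0 x\<bar>)" for x
    using sums_Suc[of "\<lambda>n. cmod (\<phi> n x)"] by (fastforce simp: \<phi>_def)
  have "h 0 x - u x + \<bar>h 0 x\<bar> \<le> 3 * B" for x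
    using bound[of 0 x] ub[of x] by linarith
  with 1 2 c show ?thesis unfolding D_class_def
    by (intro CollectI exI[of _ \<phi>] conjI allI exI[of _ "3 * B"])
      (auto simp: sums_iff)
qed

text \<open>The sup-convolutions \<open>h n\<close> with penalty \<open>n * dist y x\<close> are
  \<open>n\<close>-Lipschitz and decrease in \<open>n\<close>; upper semicontinuity and boundedness
  make \<open>u\<close> their limit, so \<open>D_class_decreasing_limit\<close> applies.\<close>

lemma D_class_upper_semicontinuous:
  fixes u :: "'a::metric_space \<Rightarrow> real"
  assumes bound: "\<And>x. \<bar>u x\<bar> \<le> B"
    and usc: "\<And>x e. e > 0 \<Longrightarrow> \<exists>d>0. \<forall>y. dist y x < d \<longrightarrow> u y < u x + e"
  shows "(\<lambda>x. complex_of_real (u x)) \<in> D_class"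
proof (rule D_class_decreasing_limit)
  define h where "h = (\<lambda>n::nat. \<lambda>x. SUP y. u y - real n * dist y x)"
  have upper: "u y - real n * dist y x \<le> B" for n x y
  proof -
    have "0 \<le> real n * dist y x" by simp
    then show ?thesis using bound[of y] by linarith
  qed
  then have bdd: "bdd_above (range (\<lambda>y. u y - real n * dist y x))" for n x
    by (intro bdd_aboveI[of _ B]) auto
  have hB: "h n x \<le> B" for n x
    unfolding h_def by (rule cSUP_least) (auto intro: upper)
  have hu: "u y - real n * dist y x \<le> h n x" for n x y
    unfolding h_def by (rule cSUP_upper[OF _ bdd]) simp
  have uh: "u x \<le> h n x" for n x
    using hu[of x n x] by simp
  show "\<bar>h n x\<bar> \<le> B" for n x
    using hB[of n x] uh[of x n] bound[of x] by linarith
  show "h (Suc n) x \<le> h n x" for n x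
    unfolding h_def by (rule cSUP_mono[OF _ bdd])
      (auto intro!: exI diff_left_mono mult_right_mono simp del: of_nat_Suc)
  have lip: "h n x \<le> h n z + real n * dist x z" for n x z
    unfolding h_def
  proof (rule cSUP_least)
    fix y
    have "real n * dist y z \<le> real n * (dist y x + dist x z)"
      by (intro mult_left_mono dist_triangle) simp
    then show "u y - real n * dist y x \<le> (SUP y. u y - real n * dist y z) + real n * dist x z"
      using hu[of y n z] unfolding h_def by (simp add: algebra_simps)
  qed simp
  show "continuous_on UNIV (h n)" for n
  proof (rule lipschitz_on_continuous_on, rule lipschitz_onI)
    show "dist (h n x) (h n z) \<le> real n * dist x z" for x z
      using lip[of n x z] lip[of n z x] by (simp add: dist_real_def dist_commute abs_le_iff)
  qed simp
  show "(\<lambda>n. h n x) \<longlonglongrightarrow> u x" for x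
  proof (rule LIMSEQ_I)
    fix e :: real assume "e > 0"
    then obtain d where d: "d > 0" "\<And>y. dist y x < d \<Longrightarrow> u y < u x + e / 2"
      using usc[of "e / 2" x] by auto
    \<comment> \<open>From \<open>n0\<close> on, the penalty at distance at least \<open>d\<close>
      exceeds \<open>2 * B\<close>, a bound for the oscillation of \<open>u\<close>, so far points
      cannot compete with \<open>x\<close> itself.\<close>
    obtain n0 where n0: "2 * B / d < real n0"
      using reals_Archimedean2 by blast
    have "norm (h n x - u x) < e" if "n \<ge> n0" for n
    proof -
      have "h n x \<le> u x + e / 2"
        unfolding h_def
      proof (rule cSUP_least)
        fix y
        show "u y - real n * dist y x \<le> u x + e / 2"
        proof (cases "dist y x < d")
          case True
          moreover have "0 \<le> real n * dist y x" by simp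
          ultimately show ?thesis using d(2)[of y] by linarith
        next
          case False
          have "2 * B < real n0 * d" using n0 d by (simp add: field_simps)
          also have "\<dots> \<le> real n * dist y x"
            using False that d by (intro mult_mono) auto
          finally show ?thesis using bound[of x] bound[of y] \<open>e > 0\<close> by linarith
        qed
      qed simp
      then show ?thesis using uh[of x n] \<open>e > 0\<close> by simp
    qed
    then show "\<exists>n0. \<forall>n\<ge>n0. norm (h n x - u x) < e" by blast
  qed
qed

section \<open>Strategies\<close>

text \<open>
  In \<open>Node \<beta> x F\<close> the player stands at \<open>x\<close>; the opponent's answer
  \<open>n\<close> names the ball of radius \<open>1 / (n + 1)\<close>, the play continues with \<open>F n\<close>,
  and \<open>\<beta>\<close> says whether the increment of that move is counted.
\<close>

datatype 'a strategy = Leaf 'a | Node bool 'a "nat \<Rightarrow> 'a strategy"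

primrec position :: "'a strategy \<Rightarrow> 'a" where
  "position (Leaf x) = x"
| "position (Node \<beta> x F) = x"

text \<open>A leaf is its own child, so that \<open>child n\<close> can be applied to a whole set of
  strategies at once.\<close>

primrec child :: "nat \<Rightarrow> 'a strategy \<Rightarrow> 'a strategy" where
  "child n (Leaf x) = Leaf x"
| "child n (Node \<beta> x F) = F n"

text \<open>The guarantee is a predicate in \<open>l\<close> and not an infimum over plays: all
  plays are finite, but they need not have a common length, so the infimum may be minus
  infinity.\<close>

primrec gains :: "('a::metric_space \<Rightarrow> real) \<Rightarrow> 'a strategy \<Rightarrow> real \<Rightarrow> bool" where
  "gains g (Leaf x) l \<longleftrightarrow> l \<le> 0"
| "gains g (Node \<beta> x F) l \<longleftrightarrow> (\<forall>n. dist (position (F n)) x < 1 / real (Suc n) \<and>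
      gains g (F n) (l - of_bool \<beta> * (g (position (F n)) - g x)))"

lemma gains_antimono: "gains g T l \<Longrightarrow> l' \<le> l \<Longrightarrow> gains g T l'"
  by (induction T arbitrary: l l') (simp, metis diff_right_mono gains.simps(2) rangeI)

text \<open>\<open>w x\<close> is the value of the game started at \<open>x\<close>. If
  \<open>w + of_bool \<beta> * g\<close> jumped up by \<open>e\<close> arbitrarily near
  \<open>x\<close>, every ball would contain such a point; moving there with flag \<beta> and
  continuing almost optimally would guarantee more than \<open>w x\<close>.\<close>

lemma D_class_bounded_gains:
  assumes bound: "\<And>x. \<bar>g x\<bar> \<le> B" and gains: "\<And>T l. gains g T l \<Longrightarrow> l \<le> L"
  shows "(\<lambda>x. complex_of_real (g x)) \<in> D_class"
proof -
  define W where "W x = {l. \<exists>T. position T = x \<and> gains g T l}" for x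
  define w where "w x = Sup (W x)" for x
  have W0: "0 \<in> W x" for x
    unfolding W_def by (auto intro!: exI[of _ "Leaf x"])
  have bdd: "bdd_above (W x)" for x
    using gains unfolding W_def by (intro bdd_aboveI[of _ L]) auto
  have w0: "0 \<le> w x" for x
    unfolding w_def using W0 bdd by (rule cSup_upper)
  have wL: "w x \<le> L" for x
    unfolding w_def using W0[of x] gains by (intro cSup_least) (blast, auto simp: W_def)
  have below: "\<exists>T. position T = x \<and> gains g T l" if "l < w x" for x l
  proof -
    have "W x \<noteq> {}" using W0[of x] by blast
    then have "\<exists>l'\<in>W x. l < l'"
      using that less_cSup_iff[OF _ bdd[of x]] unfolding w_def by metis
    then obtain l' where "l' \<in> W x" "l < l'" by blast
    then obtain T where "position T = x" "gains g T l'" unfolding W_def by auto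
    then show ?thesis using gains_antimono[of g T l' l] \<open>l < l'\<close> by auto
  qed
  have usc: "\<exists>d>0. \<forall>y. dist y x < d \<longrightarrow> w y + of_bool \<beta> * g y < w x + of_bool \<beta> * g x + e"
    if "e > 0" for x e and \<beta> :: bool
  proof (rule ccontr)
    assume contra: "\<not> ?thesis"
    \<comment> \<open>Continuing with a strategy within \<open>e / 2\<close> of the value
      \<open>w y\<close> gives up only half of the jump.\<close>
    have "\<exists>T. dist (position T) x < 1 / real (Suc n) \<and>
        gains g T (w x + e / 2 - of_bool \<beta> * (g (position T) - g x))" for n
    proof -
      obtain y where y: "dist y x < 1 / real (Suc n)"
          "w x + of_bool \<beta> * g x + e \<le> w y + of_bool \<beta> * g y"
        using contra by (metis not_le divide_pos_pos of_nat_0_less_iff zero_less_Suc zero_less_one)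
      have "w x + e / 2 - of_bool \<beta> * (g y - g x) < w y"
        using y(2) \<open>e > 0\<close> by (simp add: algebra_simps)
      from below[OF this] show ?thesis using y(1) by auto
    qed
    then obtain F where "\<And>n. dist (position (F n)) x < 1 / real (Suc n) \<and>
        gains g (F n) (w x + e / 2 - of_bool \<beta> * (g (position (F n)) - g x))" by metis
    then have "gains g (Node \<beta> x F) (w x + e / 2)" by simp
    then have "w x + e / 2 \<in> W x"
      unfolding W_def by (auto intro!: exI[of _ "Node \<beta> x F"])
    then have "w x + e / 2 \<le> w x" unfolding w_def by (rule cSup_upper[OF _ bdd])
    then show False using \<open>e > 0\<close> by simp
  qed
  have "(\<lambda>x. complex_of_real (w x + of_bool \<beta> * g x)) \<in> D_class" for \<beta>
  proof (rule D_class_upper_semicontinuous)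
    show "\<bar>w x + of_bool \<beta> * g x\<bar> \<le> L + B" for x
      using w0[of x] wL[of x] bound[of x] by (cases \<beta>) auto
  qed (rule usc)
  from D_class_linear[OF this[of True] this[of False], of "- 1"] show ?thesis by simp
qed

section \<open>Playing a strategy along a sparse subsequence\<close>

lemma sum_quarter_powers_le: "p \<le> j \<Longrightarrow> (\<Sum>i=p..<j. 1 / 4 ^ i :: real) \<le> 2 / 4 ^ p - (4 / 3) / 4 ^ j"
  by (induction j rule: dec_induct) simp_all

text \<open>Induction on the strategy. At a node the player waits until some \<open>s j\<close> is
  near \<open>of_bool \<beta>\<close>, and the opponent answers \<open>N (r j)\<close>. For
  \<open>q < i \<le> j\<close> the value of \<open>h (r i)\<close> at the final point
  \<open>t\<close> is close to \<open>f x\<close>, and that of \<open>h (r (Suc j))\<close> is close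
  to \<open>f x'\<close>, so the sum up to \<open>j\<close> is nearly the counted increment. The
  last conjunct serves the induction: it carries estimates at the positions over to
  \<open>t\<close>.\<close>

lemma strategy_play:
  fixes h :: "nat \<Rightarrow> 'a::metric_space \<Rightarrow> complex"
  assumes A_mono: "\<And>k. A k \<subseteq> A (Suc k)"
    and A_child: "\<And>k T. T \<in> A k \<Longrightarrow> child (N k) T \<in> A (Suc k)"
    and N: "\<And>k i x y. dist y x < 1 / real (Suc (N k)) \<Longrightarrow> i \<le> k \<Longrightarrow> cmod (h i y - h i x) \<le> 1 / 4 ^ k"
    and H: "\<And>k n T. H k \<le> n \<Longrightarrow> T \<in> A k \<Longrightarrow> cmod (h n (position T) - f (position T)) \<le> 1 / 4 ^ k"
    and r: "strict_mono r" "\<And>j. H (Suc (r j)) \<le> r (Suc j)"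
    and f: "\<And>x. cmod (f x) \<le> M"
    and s: "\<And>j. cmod (s j) \<le> S"
    and cluster: "\<And>\<beta> p. \<exists>j\<ge>p. cmod (s j - of_bool \<beta>) \<le> 1 / 2 ^ p"
    and a: "cmod a = 1"
  assumes "gains (\<lambda>x. Re (a * f x)) T l" "T \<in> A (Suc (r q))"
  shows "\<exists>m>q. \<exists>t. l - (28 * S + 4 * M) / 2 ^ Suc q
        \<le> Re (a * (\<Sum>i=Suc q..<m. s i * (h (r (Suc i)) t - h (r i) t))) \<and>
      (\<forall>i\<le>Suc q. cmod (h (r i) t - h (r i) (position T)) \<le> 2 / 4 ^ Suc q)"
  using assms(11-)
proof (induction T arbitrary: l q)
  case (Leaf x)
  have "0 \<le> S" using s[of 0] norm_ge_zero order_trans by blast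
  moreover have "0 \<le> M" using f[of x] norm_ge_zero order_trans by blast
  ultimately have "0 \<le> (28 * S + 4 * M) / 2 ^ Suc q" by simp
  moreover have "l \<le> 0" using Leaf by simp
  ultimately show ?case
    by (intro exI[of _ "Suc q"] conjI exI[of _ x]) auto
next
  case (Node \<beta> x F)
  have S0: "0 \<le> S" using s[of 0] norm_ge_zero order_trans by blast
  have M0: "0 \<le> M" using f[of x] norm_ge_zero order_trans by blast
  have A_le: "k \<le> k' \<Longrightarrow> T \<in> A k \<Longrightarrow> T \<in> A k'" for k k' T
    using lift_Suc_mono_le[of A, OF A_mono] by blast
  have rj: "j \<le> r j" for j using r(1) by (rule strict_mono_imp_increasing)
  have pow: "1 / 4 ^ k' \<le> (1 / 4 ^ k :: real)" if "k \<le> k'" for k k'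
    using that by (simp add: field_simps power_increasing)
  obtain j where j: "Suc q \<le> j" "cmod (s j - of_bool \<beta>) \<le> 1 / 2 ^ Suc q"
    using cluster by blast
  \<comment> \<open>The answer \<open>N (r j)\<close> makes the ball so small that
    \<open>h i\<close> changes by at most \<open>1 / 4 ^ r j\<close> for all
    \<open>i \<le> r j\<close>.\<close>
  define T' where "T' = F (N (r j))"
  define x' where "x' = position T'"
  have "Suc (r q) \<le> r j" using r(1) j(1) by (simp add: Suc_le_eq strict_mono_less)
  then have "Node \<beta> x F \<in> A (r j)" using Node.prems(2) A_le by blast
  from A_child[OF this] have T'A: "T' \<in> A (Suc (r j))" by (simp add: T'_def)
  have "T' \<in> range F" by (simp add: T'_def)
  moreover have g': "gains (\<lambda>x. Re (a * f x)) T' (l - of_bool \<beta> * (Re (a * f x') - Re (a * f x)))"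
    and x': "dist x' x < 1 / real (Suc (N (r j)))"
    using Node.prems(1) by (simp_all add: T'_def x'_def)
  ultimately obtain m t where m: "m > j"
    and IH1: "l - of_bool \<beta> * (Re (a * f x') - Re (a * f x)) - (28 * S + 4 * M) / 2 ^ Suc j
        \<le> Re (a * (\<Sum>i=Suc j..<m. s i * (h (r (Suc i)) t - h (r i) t)))"
    and IH2: "\<And>i. i \<le> Suc j \<Longrightarrow> cmod (h (r i) t - h (r i) x') \<le> 2 / 4 ^ Suc j"
    using Node.IH[OF _ g' T'A] unfolding x'_def by blast
  define b where "b = (\<lambda>i. h (r i) t)"
  have xx': "cmod (h (r i) x' - h (r i) x) \<le> 1 / 4 ^ j" if "i \<le> j" for i
  proof -
    have "r i \<le> r j" using that r(1) by (simp add: strict_mono_less_eq)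
    from N[OF x' this] pow[OF rj[of j]] show ?thesis by linarith
  qed
  have near: "cmod (h (r i) (position T) - f (position T)) \<le> 1 / 4 ^ i"
    if "T \<in> A (Suc (r k))" "k < i" for T i k
  proof -
    obtain i' where i: "i = Suc i'" using \<open>k < i\<close> by (metis less_nat_zero_code not0_implies_Suc)
    then have "Suc (r k) \<le> Suc (r i')" using that r(1) by (simp add: strict_mono_less_eq)
    then have "T \<in> A (Suc (r i'))" using that A_le by blast
    with H r(2) i have "cmod (h (r i) (position T) - f (position T)) \<le> 1 / 4 ^ Suc (r i')" by blast
    also have "\<dots> \<le> 1 / 4 ^ i" using rj[of i'] i by (intro pow) simp
    finally show ?thesis .
  qed
  have bx: "cmod (b i - h (r i) x) \<le> (3 / 2) / 4 ^ j" if "i \<le> j" for i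
    using norm_triangle_ineq[of "b i - h (r i) x'" "h (r i) x' - h (r i) x"]
      IH2[of i] xx'[OF that] that unfolding b_def by simp
  have bfx: "cmod (b i - f x) \<le> (5 / 2) / 4 ^ i" if "q < i" "i \<le> j" for i
    using norm_triangle_ineq[of "b i - h (r i) x" "h (r i) x - f x"]
      bx[OF that(2)] near[OF Node.prems(2) that(1)] pow[OF that(2)] by simp
  have bfx': "cmod (b (Suc j) - f x') \<le> (3 / 4) / 4 ^ j"
    using norm_triangle_ineq[of "b (Suc j) - h (r (Suc j)) x'" "h (r (Suc j)) x' - f x'"]
      IH2[of "Suc j"] near[OF T'A, of "Suc j"] unfolding b_def x'_def by simp
  \<comment> \<open>\<open>w\<close> collects the waiting time, in which both ends of each increment
    are close to \<open>f x\<close>; \<open>z\<close> is the error made at the move itself.\<close>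
  define w where "w = (\<Sum>i=Suc q..<j. s i * (b (Suc i) - b i))"
  define z where "z = s j * (b (Suc j) - b j) - of_bool \<beta> * (f x' - f x)"
  have "cmod w \<le> (\<Sum>i=Suc q..<j. 5 * S * (1 / 4 ^ i))"
    unfolding w_def
  proof (rule sum_norm_le)
    fix i assume i: "i \<in> {Suc q..<j}"
    have "cmod (b (Suc i) - b i) \<le> cmod (b (Suc i) - f x) + cmod (b i - f x)"
      using norm_triangle_ineq4[of "b (Suc i) - f x" "b i - f x"] by simp
    also have "\<dots> \<le> 5 * (1 / 4 ^ i)"
      using bfx[of i] bfx[of "Suc i"] i by (simp add: field_simps)
    finally have "cmod (s i) * cmod (b (Suc i) - b i) \<le> S * (5 * (1 / 4 ^ i))"
      using s S0 by (intro mult_mono) auto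
    then show "cmod (s i * (b (Suc i) - b i)) \<le> 5 * S * (1 / 4 ^ i)"
      by (simp add: norm_mult mult.commute)
  qed
  \<comment> \<open>The negative term, which drives the induction in
    \<open>sum_quarter_powers_le\<close>, is kept because it pays for the part
    \<open>4 * S / 4 ^ j\<close> of the bound for \<open>z\<close>.\<close>
  also have "\<dots> \<le> 5 * S * (2 / 4 ^ Suc q - (4 / 3) / 4 ^ j)"
    unfolding sum_distrib_left[symmetric] using S0 j(1)
    by (intro mult_left_mono sum_quarter_powers_le) auto
  finally have w: "cmod w \<le> 10 * S / 4 ^ Suc q - (20 / 3) * S / 4 ^ j"
    by (simp add: algebra_simps)
  have quarter: "(3 / 4) / 4 ^ j + (5 / 2) / 4 ^ j \<le> 4 * (1 / (4::real) ^ j)"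
    by (simp add: field_simps)
  \<comment> \<open>The first product is small because \<open>b (Suc j)\<close> is near
    \<open>f x'\<close> and \<open>b j\<close> near \<open>f x\<close>, the second because
    \<open>s j\<close> is near \<open>of_bool \<beta>\<close>.\<close>
  have "z = s j * ((b (Suc j) - f x') - (b j - f x)) + (s j - of_bool \<beta>) * (f x' - f x)"
    unfolding z_def by (simp add: algebra_simps)
  then have "cmod z \<le> cmod (s j) * cmod ((b (Suc j) - f x') - (b j - f x))
      + cmod (s j - of_bool \<beta>) * cmod (f x' - f x)"
    by (metis norm_mult norm_triangle_ineq)
  also have "\<dots> \<le> S * (4 * (1 / 4 ^ j)) + (1 / 2 ^ Suc q) * (2 * M)"
  proof (intro add_mono mult_mono s j S0)
    show "cmod ((b (Suc j) - f x') - (b j - f x)) \<le> 4 * (1 / 4 ^ j)"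
      using norm_triangle_ineq4[of "b (Suc j) - f x'" "b j - f x"] bfx' bfx[of j] j(1)
        quarter by linarith
    show "cmod (f x' - f x) \<le> 2 * M"
      using norm_triangle_ineq4[of "f x'" "f x"] f[of x] f[of x'] by linarith
  qed auto
  finally have z: "cmod z \<le> 4 * S / 4 ^ j + 2 * M / 2 ^ Suc q" by (simp add: mult.commute)
  have "{Suc q..<m} = {Suc q..<j} \<union> {j} \<union> {Suc j..<m}" using j(1) m by auto
  then have split: "(\<Sum>i=Suc q..<m. s i * (b (Suc i) - b i)) =
      w + s j * (b (Suc j) - b j) + (\<Sum>i=Suc j..<m. s i * (b (Suc i) - b i))"
    unfolding w_def by (simp add: sum.union_disjoint)
  have Re_le: "- cmod y \<le> Re (a * y)" for y
    using abs_Re_le_cmod[of "a * y"] a by (simp add: norm_mult)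
  have "Re (a * (\<Sum>i=Suc q..<m. s i * (b (Suc i) - b i))) =
      Re (a * w) + Re (a * z) + of_bool \<beta> * (Re (a * f x') - Re (a * f x))
      + Re (a * (\<Sum>i=Suc j..<m. s i * (b (Suc i) - b i)))"
    unfolding split z_def by (cases \<beta>) (simp_all add: algebra_simps)
  moreover have "l - of_bool \<beta> * (Re (a * f x') - Re (a * f x)) - (28 * S + 4 * M) / 2 ^ Suc j
      \<le> Re (a * (\<Sum>i=Suc j..<m. s i * (b (Suc i) - b i)))"
    using IH1 unfolding b_def .
  \<comment> \<open>Since \<open>j > q\<close>, the rest of the play uses at most half of the error
    allowance; the other half covers \<open>w\<close> and \<open>z\<close>.\<close>
  moreover have "(28 * S + 4 * M) / 2 ^ Suc j \<le> 14 * (S / 2 ^ Suc q) + 2 * (M / 2 ^ Suc q)"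
  proof -
    have "(28 * S + 4 * M) / 2 ^ Suc j \<le> (28 * S + 4 * M) / 2 ^ Suc (Suc q)"
      using j(1) S0 M0 by (intro divide_left_mono power_increasing) auto
    then show ?thesis by (simp add: field_simps)
  qed
  moreover have "(28 * S + 4 * M) / 2 ^ Suc q = 28 * (S / 2 ^ Suc q) + 4 * (M / 2 ^ Suc q)"
    by (simp add: field_simps)
  moreover have "cmod w \<le> 10 * (S / 2 ^ Suc q) - (20 / 3) * (S / 4 ^ j)"
  proof -
    have "S / 4 ^ Suc q \<le> S / 2 ^ Suc q"
      using S0 by (intro divide_left_mono power_mono) auto
    then show ?thesis using w by simp
  qed
  moreover have "cmod z \<le> 4 * (S / 4 ^ j) + 2 * (M / 2 ^ Suc q)" using z by simp
  moreover have "0 \<le> S / 4 ^ j" "0 \<le> S / 2 ^ Suc q" using S0 by simp_all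
  moreover note Re_le[of w] Re_le[of z]
  ultimately have "l - (28 * S + 4 * M) / 2 ^ Suc q
      \<le> Re (a * (\<Sum>i=Suc q..<m. s i * (b (Suc i) - b i)))"
    by linarith
  moreover have "cmod (b i - h (r i) x) \<le> 2 / 4 ^ Suc q" if "i \<le> Suc q" for i
  proof -
    have "(3 / 2) / 4 ^ j \<le> 2 / (4 ^ j :: real)" by (rule divide_right_mono) simp_all
    also have "\<dots> \<le> 2 / 4 ^ Suc q"
      using j(1) by (intro divide_left_mono power_increasing) auto
    finally have "(3 / 2) / 4 ^ j \<le> 2 / (4 ^ Suc q :: real)" .
    then show ?thesis using bx[of i] that j(1) by linarith
  qed
  ultimately show ?case using m j(1) unfolding b_def
    by (intro exI[of _ m] conjI exI[of _ t]) auto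
qed

section \<open>Pointwise and weak convergence\<close>

lemma Dini_decreasing_to_zero:
  fixes h :: "nat \<Rightarrow> 'a::topological_space \<Rightarrow> real"
  assumes compact: "compact (UNIV :: 'a set)"
    and cont: "\<And>n. continuous_on UNIV (h n)"
    and dec: "\<And>n x. h (Suc n) x \<le> h n x"
    and lim: "\<And>x. (\<lambda>n. h n x) \<longlonglongrightarrow> 0"
    and "e > 0"
  shows "\<exists>n. \<forall>x. h n x < e"
proof -
  define U where "U n = {x. h n x < e}" for n
  have "open (U n)" for n
    unfolding U_def using cont by (intro open_Collect_less continuous_intros)
  moreover have "UNIV \<subseteq> (\<Union>n. U n)"
  proof
    fix x
    have "\<forall>\<^sub>F n in sequentially. h n x < e"
      using lim[of x] \<open>e > 0\<close> by (rule order_tendstoD)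
    then show "x \<in> (\<Union>n. U n)"
      unfolding U_def eventually_sequentially by auto
  qed
  ultimately obtain I where I: "finite I" "UNIV \<subseteq> (\<Union>n\<in>I. U n)"
    using compactE_image[OF compact, of UNIV U] by auto
  have anti: "h n x \<le> h m x" if "m \<le> n" for m n x
    using lift_Suc_antimono_le[of "\<lambda>n. h n x"] dec that by blast
  have "h (Max I) x < e" for x
  proof -
    obtain n where "n \<in> I" "h n x < e" using I(2) unfolding U_def by blast
    then show ?thesis using anti[of n "Max I" x] I(1) by (meson Max_ge le_less_trans)
  qed
  then show ?thesis by blast
qed

text \<open>A substitute for dominated convergence with respect to a representing measure. The
  \<open>G n\<close> need not be continuous, so Dini's theorem does not apply to them. If the claim
  fails, functions \<open>U n\<close> below \<open>G n\<close> are built with decreasing moduli and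
  \<psi>-values within \<open>e / 2\<close> of the supremum \<open>p n > e\<close>. The step from
  \<open>U\<close> takes a nearly optimal \<open>u\<close> below \<open>G (Suc n)\<close> and splits
  \<open>U + u\<close>: the part below the maximum of the moduli has \<psi>-value at most
  \<open>p n\<close>, so the part below the minimum keeps almost all of
  \<open>\<psi> u\<close>.\<close>

lemma functional_dominated_eventually_small:
  fixes \<psi> :: "('a::topological_space \<Rightarrow>\<^sub>C complex) \<Rightarrow> real"
  assumes compact: "compact (UNIV :: 'a set)"
    and \<psi>: "bounded_linear \<psi>"
    and dec: "\<And>n x. G (Suc n) x \<le> G n x"
    and lim: "\<And>x. (\<lambda>n. G n x) \<longlonglongrightarrow> 0"
    and bound: "\<And>n x. G n x \<le> B"
    and "e > 0"
  shows "\<exists>n. \<forall>u. (\<forall>x. cmod (apply_bcontfun u x) \<le> G n x) \<longrightarrow> \<psi> u \<le> e"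
proof (rule ccontr)
  assume "\<not> ?thesis"
  then have contra: "\<exists>u. (\<forall>x. cmod (apply_bcontfun u x) \<le> G n x) \<and> \<psi> u > e" for n
    by (force simp: not_le)
  interpret bounded_linear \<psi> by (rule \<psi>)
  obtain K where K: "K > 0" "\<And>u. \<bar>\<psi> u\<bar> \<le> norm u * K"
    using pos_bounded by auto
  have anti: "G n x \<le> G m x" if "m \<le> n" for m n x
    using lift_Suc_antimono_le[of "\<lambda>n. G n x"] dec that by blast
  define D where "D n = {u. \<forall>x. cmod (apply_bcontfun u x) \<le> G n x}" for n
  define p where "p n = (SUP u\<in>D n. \<psi> u)" for n
  have bdd: "bdd_above (\<psi> ` D n)" for n
  proof (rule bdd_aboveI2)
    fix u assume "u \<in> D n"
    then have "norm u \<le> B"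
      using bound unfolding D_def by (intro norm_bound) (auto intro: order_trans)
    then show "\<psi> u \<le> B * K" using K(2)[of u] mult_right_mono[of "norm u" B K] K(1) by linarith
  qed
  have p_ge: "\<psi> u \<le> p n" if "u \<in> D n" for u n
    unfolding p_def using that bdd by (rule cSUP_upper)
  have p_e: "e < p n" for n
    using contra[of n] p_ge[of _ n] unfolding D_def by fastforce
  have ne: "D n \<noteq> {}" for n using contra[of n] unfolding D_def by blast
  have near: "\<exists>u\<in>D n. \<psi> u > p n - d" if "d > 0" for n d
    using less_cSUP_iff[OF ne bdd, of "p n - d" n] that unfolding p_def by simp
  \<comment> \<open>The margin halves at each step; the freed half covers the loss
    \<open>d (Suc n) / 2\<close> in the choice of \<open>u\<close> and \<open>d (Suc n) / 4\<close>
    from the summand with \<eta>.\<close>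
  define d where "d n = e / 4 / 2 ^ n" for n :: nat
  have d0: "d n > 0" for n using \<open>e > 0\<close> by (simp add: d_def)
  define P where "P n U \<longleftrightarrow> U \<in> D n \<and> \<psi> U > p n - e / 2 + d n" for n U
  have "\<exists>U. P 0 U" using near[of "e / 4" 0] \<open>e > 0\<close> unfolding P_def d_def by auto
  moreover have "\<exists>V. P (Suc n) V \<and> (\<forall>x. cmod (apply_bcontfun V x) \<le> cmod (apply_bcontfun U x))"
    if "P n U" for n U
  proof -
    obtain u where u: "u \<in> D (Suc n)" "\<psi> u > p (Suc n) - d (Suc n) / 2"
      using near[of "d (Suc n) / 2"] d0[of "Suc n"] by auto
    \<comment> \<open>\<open>U + u\<close> is split in the proportion of the minimum and the maximum of \<open>\<bar>U\<bar>\<close> and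
      \<open>\<bar>u\<bar>\<close>; \<open>\<eta>\<close> keeps the denominator positive and costs a small third summand.\<close>
    define \<eta> where "\<eta> = d (Suc n) / 4 / K"
    have \<eta>: "\<eta> > 0" using d0 K by (simp add: \<eta>_def)
    define q where "q x = cmod (apply_bcontfun U x) + cmod (apply_bcontfun u x) + \<eta>" for x
    have q: "q x > 0" for x
      unfolding q_def using \<eta> by (smt (verit) norm_ge_zero)
    define v where "v m x = complex_of_real (m x / q x) * (apply_bcontfun U x + apply_bcontfun u x)"
      for m :: "'a \<Rightarrow> real" and x
    define w where "w m = Bcontfun (v m)" for m
    have w: "apply_bcontfun (w m) x = v m x" if "continuous_on UNIV m" for m x
    proof -
      have "q x \<noteq> 0" for x using q[of x] by simp
      then have c: "continuous_on UNIV (v m)"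
        unfolding v_def q_def by (intro continuous_intros that) auto
      moreover have "bounded (range (v m))"
        using compact_continuous_image[OF c compact] by (rule compact_imp_bounded)
      ultimately show ?thesis
        unfolding w_def by (subst Bcontfun_inverse) (auto simp: bcontfun_def)
    qed
    have le: "cmod (apply_bcontfun (w m) x) \<le> m x" if "continuous_on UNIV m" "\<And>x. 0 \<le> m x" for m x
    proof -
      have "cmod (apply_bcontfun U x + apply_bcontfun u x) \<le> q x"
        using norm_triangle_ineq[of "apply_bcontfun U x" "apply_bcontfun u x"] \<eta>
        unfolding q_def by linarith
      then have "m x * cmod (apply_bcontfun U x + apply_bcontfun u x) \<le> m x * q x"
        using that(2) by (rule mult_left_mono)
      then show ?thesis
        unfolding w[OF that(1)] v_def norm_mult norm_of_real
        using that(2)[of x] q[of x] by (simp add: field_simps)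
    qed
    define mn where "mn x = min (cmod (apply_bcontfun U x)) (cmod (apply_bcontfun u x))" for x
    define mx where "mx x = max (cmod (apply_bcontfun U x)) (cmod (apply_bcontfun u x))" for x
    have c: "continuous_on UNIV mn" "continuous_on UNIV mx" "continuous_on UNIV (\<lambda>x::'a. \<eta>)"
      unfolding mn_def mx_def by (intro continuous_intros; simp)+
    have mn: "cmod (apply_bcontfun (w mn) x) \<le> mn x"
      and mx: "cmod (apply_bcontfun (w mx) x) \<le> mx x"
      and m\<eta>: "cmod (apply_bcontfun (w (\<lambda>x. \<eta>)) x) \<le> \<eta>" for x
      using le[OF c(1)] le[OF c(2)] le[OF c(3)] \<eta> unfolding mn_def mx_def by (simp_all add: max.coboundedI1)
    have "U + u = w mn + w mx + w (\<lambda>x. \<eta>)"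
    proof (rule bcontfun_eqI)
      fix x
      have "mn x + mx x + \<eta> = q x"
        unfolding mn_def mx_def q_def by simp
      then have "mn x / q x + mx x / q x + \<eta> / q x = 1"
        using q[of x] by (simp add: add_divide_distrib[symmetric])
      then have "complex_of_real (mn x / q x) + complex_of_real (mx x / q x)
          + complex_of_real (\<eta> / q x) = 1"
        by (metis of_real_1 of_real_add)
      then show "apply_bcontfun (U + u) x = apply_bcontfun (w mn + w mx + w (\<lambda>x. \<eta>)) x"
        by (simp only: plus_bcontfun.rep_eq w[OF c(1)] w[OF c(2)] w[OF c(3)] v_def
            distrib_right[symmetric] mult_1_left)
    qed
    then have "\<psi> U + \<psi> u = \<psi> (w mn) + \<psi> (w mx) + \<psi> (w (\<lambda>x. \<eta>))"
      by (metis add)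
    moreover have "\<psi> (w (\<lambda>x. \<eta>)) \<le> d (Suc n) / 4"
    proof -
      have "norm (w (\<lambda>x. \<eta>)) \<le> \<eta>" by (rule norm_bound) (rule m\<eta>)
      then have "norm (w (\<lambda>x. \<eta>)) * K \<le> \<eta> * K" using K(1) by simp
      then show ?thesis using K(2)[of "w (\<lambda>x. \<eta>)"] K(1) by (simp add: \<eta>_def)
    qed
    moreover have "\<psi> (w mx) \<le> p n"
    proof (rule p_ge)
      have "mx x \<le> G n x" for x
        using \<open>P n U\<close> u(1) dec[of n x] unfolding P_def D_def mx_def
        by (auto intro: order_trans)
      then show "w mx \<in> D n" using mx unfolding D_def by (auto intro: order_trans)
    qed
    moreover have "d n = 2 * d (Suc n)" by (simp add: d_def)
    ultimately have "\<psi> (w mn) > p (Suc n) - e / 2 + d (Suc n)"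
      using \<open>P n U\<close> u(2) d0[of "Suc n"] unfolding P_def by linarith
    moreover have "w mn \<in> D (Suc n)"
    proof -
      have "mn x \<le> G (Suc n) x" for x
        using u(1) unfolding D_def mn_def by (auto intro: min.coboundedI2)
      then show ?thesis using mn unfolding D_def by (auto intro: order_trans)
    qed
    moreover have "mn x \<le> cmod (apply_bcontfun U x)" for x by (simp add: mn_def)
    ultimately show ?thesis using mn unfolding P_def by (blast intro: order_trans)
  qed
  ultimately obtain U where U: "\<And>n. P n (U n)"
      "\<And>n x. cmod (apply_bcontfun (U (Suc n)) x) \<le> cmod (apply_bcontfun (U n) x)"
    using dependent_nat_choice[of P "\<lambda>n U V. \<forall>x. cmod (apply_bcontfun V x) \<le> cmod (apply_bcontfun U x)"]
    by metis
  \<comment> \<open>Unlike the \<open>G n\<close>, the moduli of the \<open>U n\<close> are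
    continuous, so Dini's theorem makes \<open>norm (U n)\<close> small, against
    \<open>\<psi> (U n) > p n - e / 2 > e / 2\<close>.\<close>
  have "(\<lambda>n. cmod (apply_bcontfun (U n) x)) \<longlonglongrightarrow> 0" for x
    using U(1) unfolding P_def D_def
    by (intro real_tendsto_sandwich[OF _ _ tendsto_const lim[of x]]) auto
  moreover have "continuous_on UNIV (\<lambda>x. cmod (apply_bcontfun (U n) x))" for n
    by (intro continuous_intros) simp
  ultimately obtain n where n: "\<And>x. cmod (apply_bcontfun (U n) x) < e / 2 / K"
    using Dini_decreasing_to_zero[OF compact, of "\<lambda>n x. cmod (apply_bcontfun (U n) x)" "e / 2 / K"]
      U(2) \<open>e > 0\<close> K(1) by auto
  have "norm (U n) \<le> e / 2 / K" by (rule norm_bound) (rule less_imp_le[OF n])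
  then have "norm (U n) * K \<le> e / 2" using K(1) by (simp add: field_simps)
  then have "\<psi> (U n) \<le> e / 2" using K(2)[of "U n"] by linarith
  moreover have "\<psi> (U n) > p n - e / 2" using U(1)[of n] d0[of n] unfolding P_def by linarith
  ultimately show False using p_e[of n] by linarith
qed

text \<open>The suprema \<open>G n\<close> of the tails decrease pointwise to 0 and dominate both
  \<open>g k\<close> and \<open>- g k\<close> for \<open>k \<ge> n\<close>.\<close>

lemma real_functional_pointwise_null:
  fixes \<psi> :: "('a::topological_space \<Rightarrow>\<^sub>C complex) \<Rightarrow> real"
  assumes compact: "compact (UNIV :: 'a set)"
    and \<psi>: "bounded_linear \<psi>"
    and lim: "\<And>x. (\<lambda>n. apply_bcontfun (g n) x) \<longlonglongrightarrow> 0"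
    and bound: "\<And>n x. cmod (apply_bcontfun (g n) x) \<le> B"
  shows "(\<lambda>n. \<psi> (g n)) \<longlonglongrightarrow> 0"
proof (rule LIMSEQ_I)
  fix e :: real assume "e > 0"
  define G where "G n x = (SUP k\<in>{n..}. cmod (apply_bcontfun (g k) x))" for n x
  have bdd: "bdd_above ((\<lambda>k. cmod (apply_bcontfun (g k) x)) ` A)" for x A
    using bound by (intro bdd_aboveI2[of _ _ B]) 
  have up: "cmod (apply_bcontfun (g k) x) \<le> G n x" if "n \<le> k" for k n x
    unfolding G_def using that bdd by (intro cSUP_upper) auto
  have "(\<lambda>n. G n x) \<longlonglongrightarrow> 0" for x
  proof (rule LIMSEQ_I)
    fix d :: real assume "d > 0"
    then obtain n0 where n0: "\<And>n. n \<ge> n0 \<Longrightarrow> cmod (apply_bcontfun (g n) x) < d / 2"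
      using LIMSEQ_D[OF lim[of x], of "d / 2"] by auto
    have "norm (G n x - 0) < d" if "n \<ge> n0" for n
    proof -
      have "G n x \<le> d / 2"
        unfolding G_def using n0 that by (intro cSUP_least) (auto intro: less_imp_le)
      moreover have "0 \<le> G n x" using up[of n n x] norm_ge_zero order_trans by blast
      ultimately show ?thesis using \<open>d > 0\<close> by simp
    qed
    then show "\<exists>n0. \<forall>n\<ge>n0. norm (G n x - 0) < d" by blast
  qed
  moreover have "G (Suc n) x \<le> G n x" for n x
    unfolding G_def by (rule cSUP_subset_mono[OF _ bdd]) auto
  moreover have "G n x \<le> B" for n x
    unfolding G_def using bound by (intro cSUP_least) auto
  ultimately obtain n where n: "\<And>u. (\<forall>x. cmod (apply_bcontfun u x) \<le> G n x) \<Longrightarrow> \<psi> u \<le> e / 2"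
    using functional_dominated_eventually_small[OF compact \<psi>, of G B "e / 2"] \<open>e > 0\<close> by (metis half_gt_zero)
  have "norm (\<psi> (g k) - 0) < e" if "k \<ge> n" for k
  proof -
    have "\<psi> (g k) \<le> e / 2" "\<psi> (- g k) \<le> e / 2"
      using up[OF that] by (intro n; simp)+
    moreover have "\<psi> (- g k) = - \<psi> (g k)"
      using \<psi> by (simp add: bounded_linear.linear linear_neg)
    ultimately show ?thesis using \<open>e > 0\<close> by simp
  qed
  then show "\<exists>n0. \<forall>k\<ge>n0. norm (\<psi> (g k) - 0) < e" by blast
qed

text \<open>The limit \<open>f\<close> may lie outside \<open>C(K)\<close>, so differences of far
  terms are used instead: they are continuous, bounded by \<open>2 * B\<close> and pointwise
  null.\<close>

lemma weak_Cauchy_pointwise_convergent: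
  fixes g :: "nat \<Rightarrow> ('a::metric_space \<Rightarrow>\<^sub>C complex)"
  assumes compact: "compact (UNIV :: 'a set)"
    and lim: "\<And>x. (\<lambda>n. apply_bcontfun (g n) x) \<longlonglongrightarrow> f x"
    and bound: "\<And>n x. cmod (apply_bcontfun (g n) x) \<le> B"
  shows "weak_Cauchy g"
  unfolding weak_Cauchy_def
proof (intro allI impI)
  fix \<phi> :: "('a \<Rightarrow>\<^sub>C complex) \<Rightarrow> complex"
  assume "bounded_clinear_functional \<phi>"
  then have \<phi>: "bounded_linear \<phi>" by (simp add: bounded_clinear_functional_def)
  have "Cauchy (\<lambda>n. \<phi> (g n))"
  proof (rule ccontr)
    assume "\<not> Cauchy (\<lambda>n. \<phi> (g n))"
    then obtain e where e: "e > 0" "\<And>M. \<exists>m\<ge>M. \<exists>n\<ge>M. \<not> dist (\<phi> (g m)) (\<phi> (g n)) < e"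
      unfolding Cauchy_def by blast
    then obtain m n where mn: "\<And>M. m M \<ge> M" "\<And>M. n M \<ge> M"
        "\<And>M. e \<le> dist (\<phi> (g (m M))) (\<phi> (g (n M)))"
      by (metis not_le)
    define u where "u M = g (m M) - g (n M)" for M
    have "filterlim m at_top sequentially" "filterlim n at_top sequentially"
      using mn(1,2) by (auto intro: filterlim_at_top_mono[OF filterlim_ident])
    then have "(\<lambda>M. apply_bcontfun (g (m M)) x - apply_bcontfun (g (n M)) x) \<longlonglongrightarrow> f x - f x" for x
      by (intro tendsto_diff filterlim_compose[OF lim])
    then have u0: "(\<lambda>M. apply_bcontfun (u M) x) \<longlonglongrightarrow> 0" for x
      by (simp add: u_def)
    have ub: "cmod (apply_bcontfun (u M) x) \<le> 2 * B" for M x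
      using norm_triangle_ineq4[of "apply_bcontfun (g (m M)) x" "apply_bcontfun (g (n M)) x"]
        bound[of "m M" x] bound[of "n M" x] by (simp add: u_def)
    have "(\<lambda>M. Re (\<phi> (u M))) \<longlonglongrightarrow> 0"
      using real_functional_pointwise_null[OF compact bounded_linear_compose[OF bounded_linear_Re \<phi>] u0 ub]
      by simp
    moreover have "(\<lambda>M. Im (\<phi> (u M))) \<longlonglongrightarrow> 0"
      using real_functional_pointwise_null[OF compact bounded_linear_compose[OF bounded_linear_Im \<phi>] u0 ub]
      by simp
    ultimately have "(\<lambda>M. \<phi> (u M)) \<longlonglongrightarrow> 0"
      by (simp add: tendsto_complex_iff)
    then obtain M where "cmod (\<phi> (u M)) < e"
      using LIMSEQ_D[of "\<lambda>M. \<phi> (u M)" 0 e] e(1) by auto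
    moreover have "\<phi> (u M) = \<phi> (g (m M)) - \<phi> (g (n M))"
      unfolding u_def using \<phi> by (simp add: bounded_linear.linear linear_diff)
    ultimately show False using mn(3)[of M] by (simp add: dist_norm)
  qed
  then show "convergent (\<lambda>n. \<phi> (g n))" by (simp add: Cauchy_convergent_iff)
qed

section \<open>Basic subsequences\<close>

text \<open>Newton interpolation: if \<open>u n\<close> leaves a nonzero residual \<open>v\<close>,
  a point \<open>z\<close> with \<open>v z \<noteq> 0\<close> becomes a new node, and
  \<open>w = v / v z\<close> corrects the old \<open>e j\<close> so that they vanish at
  \<open>z\<close>. The bound \<open>E\<close> does not depend on the coefficients of a later linear
  combination.\<close>

lemma finite_interpolation:
  fixes u :: "nat \<Rightarrow> 'a \<Rightarrow> complex"
  assumes bound: "\<And>i x. cmod (u i x) \<le> B"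
  shows "\<exists>k (y :: nat \<Rightarrow> 'a) E e. (\<forall>j<k. \<forall>x. cmod (e j x) \<le> E) \<and>
    (\<forall>i<n. \<forall>x. u i x = (\<Sum>j<k. u i (y j) * e j x))"
proof (induction n)
  case 0
  show ?case by (intro exI[of _ 0]) simp
next
  case (Suc n)
  then obtain k E e and y :: "nat \<Rightarrow> 'a" where E: "\<And>j x. j < k \<Longrightarrow> cmod (e j x) \<le> E"
    and e: "\<And>i x. i < n \<Longrightarrow> u i x = (\<Sum>j<k. u i (y j) * e j x)" by blast
  define v where "v x = u n x - (\<Sum>j<k. u n (y j) * e j x)" for x
  show ?case
  proof (cases "\<forall>x. v x = 0")
    case True
    then have "u i x = (\<Sum>j<k. u i (y j) * e j x)" if "i < Suc n" for i x
    proof (cases "i = n")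
      case True
      then show ?thesis using spec[OF \<open>\<forall>x. v x = 0\<close>, of x] unfolding v_def by simp
    next
      case False
      with that show ?thesis by (intro e) simp
    qed
    then show ?thesis using E by blast
  next
    case False
    then obtain z where z: "v z \<noteq> 0" by blast
    have B0: "0 \<le> B" using bound[of 0 z] norm_ge_zero order_trans by blast
    define V where "V = B + (\<Sum>j<k. B * E)"
    have v: "cmod (v x) \<le> V" for x
    proof -
      have "cmod (\<Sum>j<k. u n (y j) * e j x) \<le> (\<Sum>j<k. B * E)"
        using bound[of n] E B0 by (intro sum_norm_le) (auto simp: norm_mult intro!: mult_mono)
      then show ?thesis
        using norm_triangle_ineq4[of "u n x" "\<Sum>j<k. u n (y j) * e j x"] bound[of n x]
        unfolding V_def v_def by linarith
    qed
    define w where "w x = v x / v z" for x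
    define W where "W = V / cmod (v z)"
    have w: "cmod (w x) \<le> W" for x
      using v[of x] unfolding w_def W_def by (simp add: norm_divide divide_right_mono)
    define e' where "e' j x = (if j = k then w x else e j x - e j z * w x)" for j x
    \<comment> \<open>Used with \<open>c = 1\<close> for \<open>u n\<close> and with
      \<open>c = 0\<close> for the earlier functions, which were already reproduced.\<close>
    have interp: "f x = (\<Sum>j<Suc k. f ((y(k := z)) j) * e' j x)"
      if f: "\<And>x. f x = (\<Sum>j<k. f (y j) * e j x) + c * v x" for f c x
    proof -
      have "(\<Sum>j<Suc k. f ((y(k := z)) j) * e' j x)
          = (\<Sum>j<k. f (y j) * (e j x - e j z * w x)) + f z * w x"
        by (simp add: e'_def)
      also have "\<dots> = (f z - (\<Sum>j<k. f (y j) * e j z)) * w x + (\<Sum>j<k. f (y j) * e j x)"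
        by (simp add: algebra_simps sum_subtractf sum_distrib_left)
      also have "f z - (\<Sum>j<k. f (y j) * e j z) = c * v z"
        using f[of z] by simp
      also have "c * v z * w x + (\<Sum>j<k. f (y j) * e j x) = f x"
        using f[of x] z by (simp add: w_def)
      finally show ?thesis ..
    qed
    have "u i x = (\<Sum>j<Suc k. u i ((y(k := z)) j) * e' j x)" if "i < Suc n" for i x
    proof (cases "i = n")
      case True
      show ?thesis unfolding True by (rule interp[where c = 1]) (simp add: v_def)
    next
      case False
      with that have "i < n" by simp
      show ?thesis by (rule interp[where c = 0]) (simp only: e[OF \<open>i < n\<close>, symmetric] mult_zero_left add_0_right)
    qed
    moreover have "cmod (e' j x) \<le> max W (E + E * W)" if "j < Suc k" for j x
    proof (cases "j = k")
      case True
      then show ?thesis using w[of x] by (simp add: e'_def)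
    next
      case False
      with that have j: "j < k" by simp
      have "0 \<le> E" using E[OF j, of z] norm_ge_zero order_trans by blast
      then have "cmod (e j z * w x) \<le> E * W"
        unfolding norm_mult using E[OF j] w by (intro mult_mono) auto
      then show ?thesis
        using norm_triangle_ineq4[of "e j x" "e j z * w x"] E[OF j, of x] False by (simp add: e'_def)
    qed
    ultimately show ?thesis by blast
  qed
qed

text \<open>The vectors of the values \<open>e j x\<close> lie in a bounded part of a
  finite-dimensional space. A grid of mesh \<open>d / 2\<close> in real and imaginary parts has
  finitely many occupied cells, and one point is chosen from each.\<close>

lemma finite_approximation_points:
  fixes e :: "nat \<Rightarrow> 'a \<Rightarrow> complex"
  assumes bound: "\<And>j x. j < k \<Longrightarrow> cmod (e j x) \<le> E" and "d > 0"
  shows "\<exists>F. finite F \<and> (\<forall>x. \<exists>z\<in>F. \<forall>j<k. cmod (e j x - e j z) \<le> d)"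
proof -
  define Q where "Q x = (\<lambda>j\<in>{..<k}. (\<lfloor>2 * Re (e j x) / d\<rfloor>, \<lfloor>2 * Im (e j x) / d\<rfloor>))" for x
  define B where "B = {- \<lceil>2 * E / d\<rceil> - 1..\<lceil>2 * E / d\<rceil>}"
  have floor_mem: "\<lfloor>2 * t / d\<rfloor> \<in> B" if "\<bar>t\<bar> \<le> E" for t
  proof -
    have "2 * t / d \<le> 2 * E / d" "- (2 * E / d) \<le> 2 * t / d"
      using that \<open>d > 0\<close> by (simp_all add: field_simps)
    then show ?thesis unfolding B_def by (simp add: floor_le_iff le_floor_iff) linarith
  qed
  have "\<lfloor>2 * Re (e j x) / d\<rfloor> \<in> B" "\<lfloor>2 * Im (e j x) / d\<rfloor> \<in> B" if "j < k" for j x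
    using bound[OF that, of x] abs_Re_le_cmod[of "e j x"] abs_Im_le_cmod[of "e j x"]
    by (intro floor_mem; linarith)+
  then have "range Q \<subseteq> {..<k} \<rightarrow>\<^sub>E B \<times> B"
    unfolding Q_def by (intro image_subsetI) (simp add: restrict_PiE_iff)
  moreover have "finite ({..<k} \<rightarrow>\<^sub>E B \<times> B)"
    by (intro finite_PiE) (auto simp: B_def)
  ultimately have "finite (range Q)" by (rule finite_subset)
  then have "finite (inv_into UNIV Q ` range Q)" by simp
  moreover have "\<exists>z\<in>inv_into UNIV Q ` range Q. \<forall>j<k. cmod (e j x - e j z) \<le> d" for x
  proof (intro bexI allI impI)
    fix j assume j: "j < k"
    define z where "z = inv_into UNIV Q (Q x)"
    have "Q z = Q x" unfolding z_def by (simp add: f_inv_into_f)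
    then have "Q z j = Q x j" by simp
    then have *: "\<lfloor>2 * Re (e j z) / d\<rfloor> = \<lfloor>2 * Re (e j x) / d\<rfloor>"
      "\<lfloor>2 * Im (e j z) / d\<rfloor> = \<lfloor>2 * Im (e j x) / d\<rfloor>"
      using j by (simp_all add: Q_def)
    have near: "\<bar>s - t\<bar> \<le> d / 2" if "\<lfloor>2 * t / d\<rfloor> = \<lfloor>2 * s / d\<rfloor>" for s t
    proof -
      have "\<bar>2 * s / d - 2 * t / d\<bar> \<le> 1" using that by linarith
      moreover have "2 * s / d - 2 * t / d = 2 * (s - t) / d"
        by (simp add: right_diff_distrib diff_divide_distrib)
      ultimately show ?thesis using \<open>d > 0\<close> unfolding abs_le_iff by (simp add: field_simps)
    qed
    show "cmod (e j x - e j (inv_into UNIV Q (Q x))) \<le> d"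
      using cmod_le[of "e j x - e j z"] near[OF *(1)] near[OF *(2)] unfolding z_def by simp
  qed simp
  ultimately show ?thesis by blast
qed

text \<open>A combination is determined by its values at the nodes \<open>y j\<close>, and the
  \<open>e j\<close> vary by at most \<open>1 / (k + 1)\<close> from \<open>x\<close> to some
  \<open>z\<close> in \<open>F\<close>; so its values at \<open>x\<close> and \<open>z\<close>
  differ by at most \<open>B\<close>. Only boundedness is assumed, so the discontinuous limit
  \<open>f\<close> can be among the functions.\<close>

lemma finite_norming_set:
  fixes u :: "nat \<Rightarrow> 'a \<Rightarrow> complex"
  assumes "\<And>i x. cmod (u i x) \<le> B"
  shows "\<exists>F. finite F \<and> (\<forall>c B. (\<forall>z\<in>F. cmod (\<Sum>i<n. c i * u i z) \<le> B) \<longrightarrow>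
    (\<forall>x. cmod (\<Sum>i<n. c i * u i x) \<le> 2 * B))"
proof -
  obtain k y E and e :: "nat \<Rightarrow> 'a \<Rightarrow> complex"
    where E: "\<And>j x. j < k \<Longrightarrow> cmod (e j x) \<le> E"
    and e: "\<And>i x. i < n \<Longrightarrow> u i x = (\<Sum>j<k. u i (y j) * e j x)"
    using finite_interpolation[of u _ n, OF assms] by blast
  obtain F where F: "finite F" "\<And>x. \<exists>z\<in>F. \<forall>j<k. cmod (e j x - e j z) \<le> 1 / (real k + 1)"
    using finite_approximation_points[of k e E "1 / (real k + 1)"] E by auto
  have "cmod (\<Sum>i<n. c i * u i x) \<le> 2 * B"
    if B: "\<forall>z\<in>F \<union> y ` {..<k}. cmod (\<Sum>i<n. c i * u i z) \<le> B" for c B x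
  proof -
    define v where "v x = (\<Sum>i<n. c i * u i x)" for x
    have v: "v x = (\<Sum>j<k. v (y j) * e j x)" for x
    proof -
      have "v x = (\<Sum>i<n. \<Sum>j<k. c i * u i (y j) * e j x)"
        unfolding v_def
      proof (rule sum.cong[OF refl])
        fix i assume "i \<in> {..<n}"
        then show "c i * u i x = (\<Sum>j<k. c i * u i (y j) * e j x)"
          using e[of i x] by (simp add: sum_distrib_left mult.assoc)
      qed
      also have "\<dots> = (\<Sum>j<k. v (y j) * e j x)"
        unfolding v_def by (subst sum.swap) (simp add: sum_distrib_right)
      finally show ?thesis .
    qed
    obtain z where z: "z \<in> F" "\<And>j. j < k \<Longrightarrow> cmod (e j x - e j z) \<le> 1 / (real k + 1)"
      using F(2) by blast
    have vB: "cmod (v t) \<le> B" if "t \<in> F \<union> y ` {..<k}" for t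
      using B that unfolding v_def by blast
    have B0: "0 \<le> B" using vB[of z] z(1) norm_ge_zero order_trans by blast
    have "cmod (v x - v z) = cmod (\<Sum>j<k. v (y j) * (e j x - e j z))"
      using v[of x] v[of z] by (simp add: sum_subtractf right_diff_distrib)
    also have "\<dots> \<le> (\<Sum>j<k. B * (1 / (real k + 1)))"
    proof (rule sum_norm_le)
      fix j assume "j \<in> {..<k}"
      then show "cmod (v (y j) * (e j x - e j z)) \<le> B * (1 / (real k + 1))"
        unfolding norm_mult using vB z(2) B0 by (intro mult_mono) auto
    qed
    also have "\<dots> \<le> B" using B0 by (simp add: field_simps)
    finally have "cmod (v x - v z) \<le> B" .
    then show ?thesis
      using norm_triangle_ineq[of "v x - v z" "v z"] vB[of z] z(1) unfolding v_def by simp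
  qed
  then show ?thesis using F(1) by (intro exI[of _ "F \<union> y ` {..<k}"]) auto
qed

section \<open>Expansions and a criterion for basic sequences\<close>

lemma bounded_linear_scaleC_left: "bounded_linear (\<lambda>c. c *\<^sub>C (x :: 'b::complex_normed_vector))"
  by (rule bounded_linear_intro[where K = "norm x"])
    (simp_all add: scaleC_add_left scaleR_scaleC scaleC_scaleC norm_scaleC scaleR_conv_of_real)

lemma span_range_finite_sum:
  fixes b :: "nat \<Rightarrow> 'b::complex_vector"
  assumes "x \<in> complex_vector.span (range b)"
  shows "\<exists>a m. \<forall>n\<ge>m. x = (\<Sum>i<n. a i *\<^sub>C b i)"
  using assms
proof (induction rule: complex_vector.span_induct_alt)
  case base
  show ?case by (intro exI[of _ "\<lambda>_. 0"]) simp
next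
  case (step c x y)
  then obtain k a m where k: "x = b k" and a: "\<And>n. n \<ge> m \<Longrightarrow> y = (\<Sum>i<n. a i *\<^sub>C b i)" by blast
  have "c *\<^sub>C x + y = (\<Sum>i<n. (a i + (if i = k then c else 0)) *\<^sub>C b i)" if "n \<ge> max m (Suc k)" for n
  proof -
    have "(\<Sum>i<n. (a i + (if i = k then c else 0)) *\<^sub>C b i)
        = (\<Sum>i<n. a i *\<^sub>C b i) + (\<Sum>i<n. if i = k then c *\<^sub>C b i else 0)"
      by (simp add: scaleC_add_left sum.distrib if_distrib[of "\<lambda>t. t *\<^sub>C _"] cong: if_cong)
    then show ?thesis using a[of n] that k by (simp add: add.commute)
  qed
  then show ?case
    by (intro exI[of _ "\<lambda>i. a i + (if i = k then c else 0)"] exI[of _ "max m (Suc k)"]) blast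
qed

text \<open>The estimate bounds the \<open>n\<close>-th coefficient by
  \<open>2 * C / norm (b n)\<close> times the norm of the sum. Hence expansions are unique, and for
  elements of the span tending to \<open>x\<close> the coefficients converge.\<close>

lemma basic_sequence_Grunblum:
  fixes b :: "nat \<Rightarrow> 'b::complex_banach"
  assumes "0 \<le> C"
    and C: "\<And>c n m. n \<le> m \<Longrightarrow> norm (\<Sum>i<n. c i *\<^sub>C b i) \<le> C * norm (\<Sum>i<m. c i *\<^sub>C b i)"
    and nz: "\<And>n. b n \<noteq> 0"
  shows "basic_sequence b"
proof -
  define S where "S c n = (\<Sum>i<n. c i *\<^sub>C b i)" for c n
  have S_diff: "S (\<lambda>i. c i - c' i) n = S c n - S c' n" for c c' n
    by (simp add: S_def complex_vector.scale_left_diff_distrib sum_subtractf)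
  have C: "norm (S c n) \<le> C * norm (S c m)" if "n \<le> m" for c n m
    using assms(2)[OF that] unfolding S_def .
  have coeff: "cmod (c n) * norm (b n) \<le> 2 * C * norm (S c m)" if "n < m" for c n m
  proof -
    have "cmod (c n) * norm (b n) = norm (S c (Suc n) - S c n)"
      by (simp add: S_def norm_scaleC)
    also have "\<dots> \<le> norm (S c (Suc n)) + norm (S c n)" by (rule norm_triangle_ineq4)
    finally show ?thesis using C[of "Suc n" m c] C[of n m c] that by simp
  qed
  have exist: "\<exists>A. (\<lambda>j. A j *\<^sub>C b j) sums x" if x: "x \<in> closure (complex_vector.span (range b))" for x
  proof -
    obtain Y where "\<And>k. Y k \<in> complex_vector.span (range b)" and Y: "Y \<longlonglongrightarrow> x"
      using x unfolding closure_sequential by blast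
    then have "\<forall>k. \<exists>a m. \<forall>n\<ge>m. Y k = S a n"
      unfolding S_def by (intro allI span_range_finite_sum)
    then obtain a m where a: "\<And>k n. n \<ge> m k \<Longrightarrow> Y k = S (a k) n" by metis
    have a_diff: "S (\<lambda>i. a k i - a l i) n = Y k - Y l" if "n \<ge> max (m k) (m l)" for k l n
      using that by (simp add: S_diff a[symmetric])
    have "Cauchy (\<lambda>k. a k i)" for i
    proof (rule CauchyI)
      fix e :: real assume "e > 0"
      define d where "d = e * norm (b i) / (2 * C + 1)"
      have "d > 0" using \<open>e > 0\<close> nz[of i] \<open>0 \<le> C\<close> by (simp add: d_def)
      then obtain K where K: "\<And>k l. k \<ge> K \<Longrightarrow> l \<ge> K \<Longrightarrow> norm (Y k - Y l) < d"
        using CauchyD[OF LIMSEQ_imp_Cauchy[OF Y]] by blast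
      have "norm (a k i - a l i) < e" if "k \<ge> K" "l \<ge> K" for k l
      proof -
        have "cmod (a k i - a l i) * norm (b i) \<le> 2 * C * norm (Y k - Y l)"
          using coeff[of i "max (Suc i) (max (m k) (m l))" "\<lambda>i. a k i - a l i"] a_diff[of k l] by simp
        also have "\<dots> \<le> 2 * C * d"
          using K[OF that] \<open>0 \<le> C\<close> by (intro mult_left_mono) auto
        also have "\<dots> < (2 * C + 1) * d" using \<open>d > 0\<close> by (simp add: algebra_simps)
        also have "\<dots> = e * norm (b i)" using \<open>0 \<le> C\<close> by (simp add: d_def)
        finally show ?thesis using nz[of i] by simp
      qed
      then show "\<exists>K. \<forall>k\<ge>K. \<forall>l\<ge>K. norm (a k i - a l i) < e" by blast
    qed
    then have "\<forall>i. \<exists>L. (\<lambda>k. a k i) \<longlonglongrightarrow> L"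
      by (simp add: Cauchy_convergent_iff convergent_def)
    then obtain A where A: "\<And>i. (\<lambda>k. a k i) \<longlonglongrightarrow> A i" by metis
    \<comment> \<open>The bound is uniform in \<open>n\<close>, which allows the limits in
      \<open>k\<close> and \<open>n\<close> to be exchanged.\<close>
    have tail: "norm (S (a k) n - S A n) \<le> C * norm (Y k - x)" for k n
    proof (rule LIMSEQ_le)
      show "(\<lambda>l. norm (S (a k) n - S (a l) n)) \<longlonglongrightarrow> norm (S (a k) n - S A n)"
        unfolding S_def
        by (intro tendsto_norm tendsto_diff tendsto_const tendsto_sum
            bounded_linear.tendsto[OF bounded_linear_scaleC_left] A)
      show "(\<lambda>l. C * norm (Y k - Y l)) \<longlonglongrightarrow> C * norm (Y k - x)"
        by (intro tendsto_intros Y)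
      show "\<exists>N. \<forall>l\<ge>N. norm (S (a k) n - S (a l) n) \<le> C * norm (Y k - Y l)"
      proof (intro exI[of _ 0] allI impI)
        fix l
        show "norm (S (a k) n - S (a l) n) \<le> C * norm (Y k - Y l)"
          using C[of n "max n (max (m k) (m l))" "\<lambda>i. a k i - a l i"]
            a_diff[of k l "max n (max (m k) (m l))"] by (simp add: S_diff)
      qed
    qed
    have "S A \<longlonglongrightarrow> x"
    proof (rule LIMSEQ_I)
      fix e :: real assume "e > 0"
      then obtain k where k: "norm (Y k - x) < e / (C + 1)"
        using LIMSEQ_D[OF Y, of "e / (C + 1)"] \<open>0 \<le> C\<close> by auto
      have "norm (S A n - x) < e" if "n \<ge> m k" for n
      proof -
        have "norm (S A n - x) \<le> norm (Y k - x) + norm (S (a k) n - S A n)"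
          using norm_triangle_ineq4[of "Y k - x" "S (a k) n - S A n"] a[OF that] by simp
        also have "\<dots> \<le> (C + 1) * norm (Y k - x)"
          using tail[of k n] by (simp add: algebra_simps)
        also have "\<dots> < e" using k \<open>0 \<le> C\<close> by (simp add: field_simps)
        finally show ?thesis .
      qed
      then show "\<exists>N. \<forall>n\<ge>N. norm (S A n - x) < e" by blast
    qed
    then show ?thesis unfolding sums_def S_def by blast
  qed
  have unique: "c = c'"
    if "(\<lambda>j. c j *\<^sub>C b j) sums x" "(\<lambda>j. c' j *\<^sub>C b j) sums x" for c c' x
  proof
    fix n
    have "(\<lambda>m. S (\<lambda>i. c i - c' i) m) \<longlonglongrightarrow> x - x"
      using that unfolding sums_def S_diff unfolding S_def by (rule tendsto_diff)
    then have "(\<lambda>m. 2 * C * norm (S (\<lambda>i. c i - c' i) m)) \<longlonglongrightarrow> 2 * C * norm (x - x)"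
      by (intro tendsto_intros)
    moreover have "\<exists>N. \<forall>m\<ge>N. cmod (c n - c' n) * norm (b n) \<le> 2 * C * norm (S (\<lambda>i. c i - c' i) m)"
      using coeff[of n _ "\<lambda>i. c i - c' i"] by (intro exI[of _ "Suc n"]) auto
    ultimately have "cmod (c n - c' n) * norm (b n) \<le> 2 * C * norm (x - x)"
      by (rule LIMSEQ_le_const)
    then show "c n = c' n" using nz[of n] by (simp add: mult_le_0_iff)
  qed
  have "range b \<subseteq> closure (complex_vector.span (range b))"
    by (rule order_trans[OF complex_vector.span_superset closure_subset])
  then show ?thesis
    unfolding basic_sequence_def schauder_basis_of_def using exist unique by blast
qed

section \<open>Norm estimates from the distance of the limit to the continuous functions\<close>

lemma uniform_distance_from_continuous:
  fixes f :: "'a::topological_space \<Rightarrow> complex"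
  assumes "\<not> continuous_on UNIV f"
  shows "\<exists>d>0. \<forall>h. continuous_on UNIV h \<longrightarrow> (\<exists>x. d \<le> cmod (f x - h x))"
proof (rule ccontr)
  assume contra: "\<not> ?thesis"
  have "\<exists>h. continuous_on UNIV h \<and> (\<forall>x. cmod (f x - h x) < inverse (real (Suc n)))" for n
    using contra by (force simp: not_le)
  then obtain h where h: "\<And>n. continuous_on UNIV (h n)"
      "\<And>n x. cmod (f x - h n x) < inverse (real (Suc n))" by metis
  have "uniform_limit UNIV h f sequentially"
  proof (rule uniform_limitI)
    fix e :: real assume "e > 0"
    have "\<forall>\<^sub>F n in sequentially. inverse (real (Suc n)) < e"
      using LIMSEQ_inverse_real_of_nat \<open>e > 0\<close> by (rule order_tendstoD)
    then show "\<forall>\<^sub>F n in sequentially. \<forall>x\<in>UNIV. dist (h n x) (f x) < e"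
      by eventually_elim (auto simp: dist_norm norm_minus_commute intro: less_trans[OF h(2)])
  qed
  then have "continuous_on UNIV f"
    by (rule uniform_limit_theorem[rotated]) (auto simp: h)
  with assms show False by simp
qed

text \<open>The least \<open>l\<close> with \<open>r i < l\<close> for all \<open>i < j\<close>, when \<open>r\<close> is strictly increasing.\<close>

definition index_bound :: "(nat \<Rightarrow> nat) \<Rightarrow> nat \<Rightarrow> nat" where
  "index_bound r j = (case j of 0 \<Rightarrow> 0 | Suc i \<Rightarrow> Suc (r i))"

lemma index_bound_mono:
  assumes "strict_mono r" shows "i \<le> j \<Longrightarrow> index_bound r i \<le> index_bound r j"
  using assms by (auto simp: index_bound_def strict_mono_less_eq split: nat.splits)

lemma index_bound_ge:
  assumes "strict_mono r" shows "j \<le> index_bound r j"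
  using strict_mono_imp_increasing[OF assms] by (auto simp: index_bound_def split: nat.splits)

lemma sum_half_powers_le: "(\<Sum>i=n..<m. (1 / 2) ^ i :: real) \<le> 2"
proof -
  have "(\<Sum>i=n..<m. (1 / 2) ^ i :: real) \<le> (\<Sum>i<m. (1 / 2) ^ i)"
    by (rule sum_mono2) auto
  also have "\<dots> = 2 - 2 * (1 / 2) ^ m" by (induction m) simp_all
  also have "\<dots> \<le> 2" by simp
  finally show ?thesis .
qed

text \<open>On a finite norming set chosen before step \<open>n\<close>, all later
  \<open>b i\<close> are close to \<open>f\<close>, so the full sum is close to its first
  \<open>n\<close> terms plus \<open>t n * f\<close>, with \<open>t n\<close> the tail sum of the
  coefficients. This bounds the norm of the latter; the distance \<open>d\<close> of
  \<open>f\<close> from continuous functions then bounds \<open>t n\<close>, and removing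
  \<open>t n * f\<close> bounds the partial sum.\<close>

lemma sparse_subsequence_estimate:
  fixes f :: "'a::metric_space \<Rightarrow> complex" and fs :: "nat \<Rightarrow> ('a \<Rightarrow>\<^sub>C complex)"
  assumes bound: "\<And>n x. cmod (apply_bcontfun (fs n) x) \<le> M"
    and lim: "\<And>x. (\<lambda>n. apply_bcontfun (fs n) x) \<longlonglongrightarrow> f x"
    and disc: "\<not> continuous_on UNIV f"
  shows "\<exists>H C. 0 \<le> C \<and> (\<forall>r. strict_mono r \<and> (\<forall>j. H (index_bound r j) \<le> r j) \<longrightarrow>
    (\<forall>c n m. n \<le> m \<longrightarrow>
      cmod (\<Sum>i=n..<m. c i) \<le> C * norm (\<Sum>i<m. c i *\<^sub>C fs (r i)) \<and>
      norm (\<Sum>i<n. c i *\<^sub>C fs (r i)) \<le> C * norm (\<Sum>i<m. c i *\<^sub>C fs (r i))))"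
proof -
  have fM: "cmod (f x) \<le> M" for x
    using bound by (intro LIMSEQ_le_const2[OF tendsto_norm[OF lim]]) auto
  have M0: "0 \<le> M" using fM norm_ge_zero order_trans by blast
  obtain d where d: "d > 0" "\<And>h. continuous_on UNIV h \<Longrightarrow> \<exists>x. d \<le> cmod (f x - h x)"
    using uniform_distance_from_continuous[OF disc] by blast
  define norms where "norms l F \<longleftrightarrow> finite F \<and>
      (\<forall>c B. (\<forall>z\<in>F. cmod ((\<Sum>i<l. c i * apply_bcontfun (fs i) z) + c l * f z) \<le> B) \<longrightarrow>
      (\<forall>x. cmod ((\<Sum>i<l. c i * apply_bcontfun (fs i) x) + c l * f x) \<le> 2 * B))" for l F
  have "\<exists>F. norms l F" for l
    using finite_norming_set[of "\<lambda>i x. if i < l then apply_bcontfun (fs i) x else f x" M "Suc l"]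
      bound fM unfolding norms_def by simp
  then obtain F where norms: "\<And>l. norms l (F l)" by metis
  then have F: "\<And>l. finite (F l)" unfolding norms_def by blast
  have norming: "cmod ((\<Sum>i<l. c i * apply_bcontfun (fs i) x) + c l * f x) \<le> 2 * B"
    if "\<And>z. z \<in> F l \<Longrightarrow> cmod ((\<Sum>i<l. c i * apply_bcontfun (fs i) z) + c l * f z) \<le> B" for l c B x
    using norms[of l] that unfolding norms_def by blast
  \<comment> \<open>With this value the error \<open>8 * A * \<kappa>\<close> in the bound for
    \<open>d * A\<close> is \<open>d * A / 2\<close> and can be absorbed.\<close>
  define \<kappa> where "\<kappa> = d / 16"
  have \<kappa>: "\<kappa> > 0" using d(1) by (simp add: \<kappa>_def)
  \<comment> \<open>All sets \<open>F l'\<close> with \<open>l' \<le> l\<close> are included because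
    an index \<open>i\<close> must respect the norming sets of every earlier step
    \<open>n\<close>.\<close>
  have "\<exists>H. \<forall>k\<ge>H. \<forall>z\<in>(\<Union>l'\<le>l. F l'). cmod (apply_bcontfun (fs k) z - f z) \<le> \<kappa> * (1 / 2) ^ l" for l
  proof -
    have "\<forall>\<^sub>F k in sequentially. \<forall>z\<in>(\<Union>l'\<le>l. F l'). cmod (apply_bcontfun (fs k) z - f z) < \<kappa> * (1 / 2) ^ l"
      using F \<kappa> tendstoD[OF lim, of "\<kappa> * (1 / 2) ^ l"]
      by (intro eventually_ball_finite) (auto simp: dist_norm)
    then show ?thesis unfolding eventually_sequentially by (meson less_imp_le)
  qed
  then obtain H where H: "\<And>l k z. k \<ge> H l \<Longrightarrow> z \<in> (\<Union>l'\<le>l. F l') \<Longrightarrow>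
      cmod (apply_bcontfun (fs k) z - f z) \<le> \<kappa> * (1 / 2) ^ l" by metis
  define C where "C = 4 + 4 / d + 4 * M / d"
  have "cmod (\<Sum>i=n..<m. c i) \<le> C * norm (\<Sum>i<m. c i *\<^sub>C fs (r i)) \<and>
      norm (\<Sum>i<n. c i *\<^sub>C fs (r i)) \<le> C * norm (\<Sum>i<m. c i *\<^sub>C fs (r i))"
    if r: "strict_mono r" "\<And>j. H (index_bound r j) \<le> r j" and "n \<le> m" for r c n m
  proof -
    define b where "b i = apply_bcontfun (fs (r i))" for i
    define Y where "Y = norm (\<Sum>i<m. c i *\<^sub>C fs (r i))"
    have apply_sum: "apply_bcontfun (\<Sum>i<n. c i *\<^sub>C fs (r i)) x = (\<Sum>i<n. c i * b i x)" for n x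
      by (induction n) (simp_all add: b_def plus_bcontfun.rep_eq)
    have Y: "cmod (\<Sum>i<m. c i * b i x) \<le> Y" for x
      unfolding Y_def apply_sum[symmetric] by (rule norm_bounded)
    define t where "t n = (\<Sum>i=n..<m. c i)" for n
    \<comment> \<open>The errors are measured by the largest tail sum; each \<open>c i\<close> is a
      difference of two consecutive tails, hence at most \<open>2 * A\<close>.\<close>
    define A where "A = Max ((\<lambda>n. cmod (t n)) ` {..m})"
    have A: "cmod (t n) \<le> A" if "n \<le> m" for n
      unfolding A_def using that by (intro Max_ge) auto
    have "A \<in> (\<lambda>n. cmod (t n)) ` {..m}" unfolding A_def by (rule Max_in) auto
    then obtain n0 where n0: "n0 \<le> m" "A = cmod (t n0)" by auto
    have A0: "0 \<le> A" using n0 by simp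
    have cA: "cmod (c i) \<le> 2 * A" if "i < m" for i
    proof -
      have "c i = t i - t (Suc i)" unfolding t_def using that by (simp add: sum.atLeast_Suc_lessThan)
      then show ?thesis using norm_triangle_ineq4[of "t i" "t (Suc i)"] A[of i] A[of "Suc i"] that by simp
    qed
    define B where "B = Y + 4 * A * \<kappa>"
    have v: "cmod ((\<Sum>i<n. c i * b i x) + t n * f x) \<le> 2 * B" if "n \<le> m" for n x
    proof -
      define l where "l = index_bound r n"
      have near: "cmod ((\<Sum>i<n. c i * b i z) + t n * f z) \<le> B" if "z \<in> F l" for z
      proof -
        have err: "cmod (b i z - f z) \<le> \<kappa> * (1 / 2) ^ i" if "n \<le> i" for i
        proof -
          have "l \<le> index_bound r i" unfolding l_def using index_bound_mono[OF r(1) that] .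
          then have "cmod (b i z - f z) \<le> \<kappa> * (1 / 2) ^ index_bound r i"
            unfolding b_def using \<open>z \<in> F l\<close> by (intro H r) auto
          also have "\<dots> \<le> \<kappa> * (1 / 2) ^ i"
            using \<kappa> index_bound_ge[OF r(1)] by (intro mult_left_mono power_decreasing) auto
          finally show ?thesis .
        qed
        have "(\<Sum>i<m. c i * b i z) = (\<Sum>i<n. c i * b i z) + (\<Sum>i=n..<m. c i * b i z)"
          using \<open>n \<le> m\<close> by (simp add: lessThan_atLeast0 sum.atLeastLessThan_concat)
        then have "(\<Sum>i<n. c i * b i z) + t n * f z
            = (\<Sum>i<m. c i * b i z) - (\<Sum>i=n..<m. c i * (b i z - f z))"
          unfolding t_def by (simp add: right_diff_distrib sum_subtractf sum_distrib_right)
        moreover have "cmod (\<Sum>i=n..<m. c i * (b i z - f z)) \<le> (\<Sum>i=n..<m. 2 * A * \<kappa> * (1 / 2) ^ i)"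
        proof (rule sum_norm_le)
          fix i assume "i \<in> {n..<m}"
          then have "cmod (c i) * cmod (b i z - f z) \<le> 2 * A * (\<kappa> * (1 / 2) ^ i)"
            using cA err A0 by (intro mult_mono) auto
          then show "cmod (c i * (b i z - f z)) \<le> 2 * A * \<kappa> * (1 / 2) ^ i"
            by (simp add: norm_mult mult.assoc)
        qed
        moreover have "(\<Sum>i=n..<m. 2 * A * \<kappa> * (1 / 2) ^ i) \<le> 2 * A * \<kappa> * 2"
          unfolding sum_distrib_left[symmetric] using A0 \<kappa>
          by (intro mult_left_mono sum_half_powers_le) simp
        ultimately show ?thesis
          using norm_triangle_ineq4[of "\<Sum>i<m. c i * b i z" "\<Sum>i=n..<m. c i * (b i z - f z)"] Y[of z]
          unfolding B_def by simp
      qed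
      \<comment> \<open>The combination is rewritten over \<open>fs k\<close> for
        \<open>k < l\<close>, the form that \<open>norming\<close> expects, with \<open>t n\<close>
        as coefficient of \<open>f\<close>.\<close>
      define e where "e k = (if k < l then \<Sum>i | i < n \<and> r i = k. c i else t n)" for k
      have rl: "r i < l" if "i < n" for i
        using that r(1) unfolding l_def index_bound_def
        by (cases n) (auto simp: strict_mono_less_eq less_Suc_eq_le)
      have e: "(\<Sum>k<l. e k * apply_bcontfun (fs k) x) + e l * f x = (\<Sum>i<n. c i * b i x) + t n * f x" for x
      proof -
        have "(\<Sum>k<l. e k * apply_bcontfun (fs k) x)
            = (\<Sum>k<l. \<Sum>i\<in>{i \<in> {..<n}. r i = k}. c i * b i x)"
          by (intro sum.cong) (auto simp: e_def b_def sum_distrib_right intro!: sum.cong)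
        also have "\<dots> = (\<Sum>i<n. c i * b i x)"
          using rl by (intro sum.group) auto
        finally show ?thesis by (simp add: e_def)
      qed
      show ?thesis using norming[of l e B x] near unfolding e by blast
    qed
    have tB: "d * cmod (t n) \<le> 2 * B" if "n \<le> m" for n
    proof (cases "t n = 0")
      case True
      then show ?thesis using v[OF that] norm_ge_zero by (metis mult_zero_right norm_zero order_trans)
    next
      case False
      have "continuous_on UNIV (\<lambda>x. - (\<Sum>i<n. c i * b i x) / t n)"
        unfolding b_def by (intro continuous_intros) (auto simp: False)
      then obtain x where x: "d \<le> cmod (f x - (- (\<Sum>i<n. c i * b i x) / t n))"
        using d(2) by blast
      have "(\<Sum>i<n. c i * b i x) + t n * f x = t n * (f x - (- (\<Sum>i<n. c i * b i x) / t n))"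
        using False by (simp add: field_simps)
      then have "cmod (t n) * cmod (f x - (- (\<Sum>i<n. c i * b i x) / t n)) \<le> 2 * B"
        using v[OF that, of x] by (simp only: norm_mult)
      then show ?thesis using mult_left_mono[OF x, of "cmod (t n)"] by (simp add: mult.commute)
    qed
    have "d * A \<le> 2 * Y + d * A / 2"
      using tB[OF n0(1)] unfolding n0(2)[symmetric] B_def \<kappa>_def by (simp add: mult.commute)
    then have dA: "d * A \<le> 4 * Y" by simp
    have Y0: "0 \<le> Y" by (simp add: Y_def)
    have "A \<le> 4 * Y / d"
      by (rule mult_imp_le_div_pos[OF d(1)]) (subst mult.commute, rule dA)
    then have A_le: "A \<le> 4 / d * Y" by simp
    have "4 * A * \<kappa> = d * A / 4" by (simp add: \<kappa>_def)
    then have B_le: "B \<le> 2 * Y" using dA Y0 unfolding B_def by linarith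
    have AM: "A * M \<le> 4 * M / d * Y" using mult_right_mono[OF A_le M0] by (simp add: mult_ac)
    have CY: "C * Y = 4 * Y + 4 / d * Y + 4 * M / d * Y" by (simp add: C_def algebra_simps)
    have dY: "0 \<le> 4 / d * Y" "0 \<le> 4 * M / d * Y" using d(1) Y0 M0 by simp_all
    have "cmod (t n) \<le> C * Y"
      using A[OF \<open>n \<le> m\<close>] A_le CY dY Y0 by linarith
    moreover have "norm (\<Sum>i<n. c i *\<^sub>C fs (r i)) \<le> C * Y"
    proof (rule norm_bound)
      fix x
      have "cmod (t n * f x) \<le> A * M"
        unfolding norm_mult using A[OF \<open>n \<le> m\<close>] fM A0 by (intro mult_mono) auto
      then show "cmod (apply_bcontfun (\<Sum>i<n. c i *\<^sub>C fs (r i)) x) \<le> C * Y"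
        using norm_triangle_ineq4[of "(\<Sum>i<n. c i * b i x) + t n * f x" "t n * f x"]
          v[OF \<open>n \<le> m\<close>, of x] B_le AM CY dY unfolding apply_sum by simp
    qed
    ultimately show ?thesis unfolding t_def Y_def by blast
  qed
  moreover have "0 \<le> C" using d(1) M0 by (simp add: C_def)
  ultimately show ?thesis by blast
qed

section \<open>Summing subsequences\<close>

text \<open>The factor \<open>a\<close> treats both parts of \<open>f\<close> alike:
  \<open>a = 1\<close> gives the real part and \<open>a = - \<i>\<close> the imaginary part.\<close>

lemma unbounded_gains_outside_D_class:
  assumes bound: "\<And>x. cmod (f x) \<le> M" and f: "f \<notin> D_class"
  shows "\<exists>a. cmod a = 1 \<and> (\<forall>l. \<exists>T. gains (\<lambda>x. Re (a * f x)) T l)"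
proof (rule ccontr)
  assume contra: "\<not> ?thesis"
  have D: "(\<lambda>x. complex_of_real (Re (a * f x))) \<in> D_class" if a: "cmod a = 1" for a
  proof -
    obtain L where L: "\<And>T. \<not> gains (\<lambda>x. Re (a * f x)) T L"
      using contra a by blast
    show ?thesis
    proof (rule D_class_bounded_gains)
      show "\<bar>Re (a * f x)\<bar> \<le> M" for x
        using abs_Re_le_cmod[of "a * f x"] bound[of x] a by (simp add: norm_mult)
      show "l \<le> L" if "gains (\<lambda>x. Re (a * f x)) T l" for T l
        using gains_antimono[OF that, of L] L[of T] by linarith
    qed
  qed
  have "(\<lambda>x. complex_of_real (Re (1 * f x)) + \<i> * complex_of_real (Re (- \<i> * f x))) \<in> D_class"
    by (intro D_class_linear D) simp_all
  moreover have "complex_of_real (Re (1 * f x)) + \<i> * complex_of_real (Re (- \<i> * f x)) = f x" for x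
    by (simp add: complex_eq_iff)
  ultimately show False using f by simp
qed

lemma uniform_modulus_finite_family:
  fixes h :: "nat \<Rightarrow> 'a::metric_space \<Rightarrow> complex"
  assumes compact: "compact (UNIV :: 'a set)" and cont: "\<And>i. continuous_on UNIV (h i)" and "e > 0"
  shows "\<exists>N. \<forall>i\<le>k. \<forall>x y. dist y x < 1 / real (Suc N) \<longrightarrow> cmod (h i y - h i x) \<le> e"
proof -
  have "\<exists>N. \<forall>x y. dist y x < 1 / real (Suc N) \<longrightarrow> cmod (h i y - h i x) \<le> e" for i
  proof -
    have "uniformly_continuous_on UNIV (h i)"
      using cont compact by (rule compact_uniformly_continuous)
    then obtain d where d: "d > 0" "\<And>x y. dist y x < d \<Longrightarrow> dist (h i y) (h i x) < e"
      using \<open>e > 0\<close> unfolding uniformly_continuous_on_def by (metis UNIV_I)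
    obtain N where "1 / real (Suc N) < d" using \<open>d > 0\<close> by (rule nat_approx_posE)
    then show ?thesis using d(2) by (intro exI[of _ N]) (force simp: dist_norm intro: less_imp_le)
  qed
  then obtain N where N: "\<And>i x y. dist y x < 1 / real (Suc (N i)) \<Longrightarrow> cmod (h i y - h i x) \<le> e"
    by metis
  have "cmod (h i y - h i x) \<le> e"
    if "i \<le> k" "dist y x < 1 / real (Suc (\<Sum>i\<le>k. N i))" for i x y
  proof (rule N)
    have "N i \<le> (\<Sum>i\<le>k. N i)" using that(1) by (intro member_le_sum) auto
    then have "1 / real (Suc (\<Sum>i\<le>k. N i)) \<le> 1 / real (Suc (N i))"
      by (intro divide_left_mono) (simp_all del: of_nat_Suc)
    with that(2) show "dist y x < 1 / real (Suc (N i))" by (rule less_le_trans)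
  qed
  then show ?thesis by blast
qed

text \<open>Bolzano-Weierstrass gives \<open>u\<close>; it is applied again to terms that stay at
  distance at least \<open>d\<close> from \<open>u\<close>.\<close>

lemma bounded_divergent_cluster_points:
  fixes \<sigma> :: "nat \<Rightarrow> complex"
  assumes bound: "\<And>n. cmod (\<sigma> n) \<le> B" and div: "\<not> convergent \<sigma>"
  shows "\<exists>u v. u \<noteq> v \<and> (\<forall>e>0. \<forall>p. \<exists>j\<ge>p. cmod (\<sigma> j - u) \<le> e) \<and> (\<forall>e>0. \<forall>p. \<exists>j\<ge>p. cmod (\<sigma> j - v) \<le> e)"
proof -
  have limit: "\<exists>l r. strict_mono r \<and> (\<lambda>n. \<sigma> (q (r n))) \<longlonglongrightarrow> l" for q :: "nat \<Rightarrow> nat"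
  proof -
    have "bounded (range (\<lambda>n. \<sigma> (q n)))" using bound unfolding bounded_iff by blast
    from bounded_imp_convergent_subsequence[OF this] show ?thesis
      unfolding o_def .
  qed
  have cluster: "\<exists>j\<ge>p. cmod (\<sigma> j - l) \<le> e"
    if kl: "(\<lambda>n. \<sigma> (k n)) \<longlonglongrightarrow> l" and k: "\<And>n. n \<le> k n" and e: "e > 0" for k l e p
  proof -
    obtain n0 where "\<And>n. n \<ge> n0 \<Longrightarrow> cmod (\<sigma> (k n) - l) < e"
      using LIMSEQ_D[OF kl e] by blast
    then have "cmod (\<sigma> (k (max n0 p)) - l) \<le> e" by (simp add: less_imp_le)
    moreover have "p \<le> k (max n0 p)" using k[of "max n0 p"] by linarith
    ultimately show ?thesis by blast
  qed
  obtain u r where r: "strict_mono r" and u: "(\<lambda>n. \<sigma> (r n)) \<longlonglongrightarrow> u"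
    using limit[of "\<lambda>n. n"] by blast
  have "\<not> \<sigma> \<longlonglongrightarrow> u" using div unfolding convergent_def by blast
  then obtain d where d: "d > 0" "\<And>n. \<exists>k\<ge>n. d \<le> cmod (\<sigma> k - u)"
    unfolding LIMSEQ_iff by (metis not_le)
  then obtain q where q: "\<And>n. n \<le> q n" "\<And>n. d \<le> cmod (\<sigma> (q n) - u)" by metis
  obtain v r' where r': "strict_mono r'" and v: "(\<lambda>n. \<sigma> (q (r' n))) \<longlonglongrightarrow> v"
    using limit[of q] by blast
  have "d \<le> cmod (v - u)"
    using q(2) by (intro LIMSEQ_le_const[OF tendsto_norm[OF tendsto_diff[OF v tendsto_const]]]) blast
  then have "u \<noteq> v" using d(1) by auto
  moreover have "n \<le> r n" "n \<le> q (r' n)" for n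
    using strict_mono_imp_increasing[OF r, of n] strict_mono_imp_increasing[OF r', of n] q(1)[of "r' n"]
    by linarith+
  ultimately show ?thesis using cluster[OF u] cluster[OF v] by blast
qed

text \<open>\<open>H\<close> must not depend on \<open>r\<close> or \<open>c\<close>. This is
  possible because the opponent only ever gives the answers \<open>N k\<close>, so the relevant
  positions can be listed in advance. For a divergent series the bounded Abel sums then contradict
  the strategies with arbitrarily large gain.\<close>

lemma sparse_subsequence_summing:
  fixes f :: "'a::metric_space \<Rightarrow> complex" and h :: "nat \<Rightarrow> 'a \<Rightarrow> complex"
  assumes compact: "compact (UNIV :: 'a set)"
    and cont: "\<And>n. continuous_on UNIV (h n)"
    and bound: "\<And>n x. cmod (h n x) \<le> M"
    and lim: "\<And>x. (\<lambda>n. h n x) \<longlonglongrightarrow> f x"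
    and f: "f \<notin> D_class"
  shows "\<exists>H. \<forall>r. strict_mono r \<and> (\<forall>j. H (index_bound r j) \<le> r j) \<longrightarrow>
    (\<forall>c B. (\<forall>n x. cmod (\<Sum>i<n. c i * h (r i) x) \<le> B) \<and> (\<forall>n. cmod (\<Sum>i<n. c i) \<le> B) \<longrightarrow> summable c)"
proof -
  have fM: "cmod (f x) \<le> M" for x
    using bound by (intro LIMSEQ_le_const2[OF tendsto_norm[OF lim]]) auto
  have M0: "0 \<le> M" using fM norm_ge_zero order_trans by blast
  obtain a where a: "cmod a = 1" "\<And>l. \<exists>T. gains (\<lambda>x. Re (a * f x)) T l"
    using unbounded_gains_outside_D_class[OF fM f] by blast
  have "\<exists>T. \<forall>n::nat. gains (\<lambda>x. Re (a * f x)) (T n) (real n)"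
    by (rule choice) (use a(2) in blast)
  then obtain T where T: "\<And>n::nat. gains (\<lambda>x. Re (a * f x)) (T n) (real n)" by blast
  have "\<exists>N. \<forall>i\<le>k. \<forall>x y. dist y x < 1 / real (Suc N) \<longrightarrow> cmod (h i y - h i x) \<le> 1 / 4 ^ k" for k
    by (rule uniform_modulus_finite_family[OF compact cont]) simp
  then obtain N where N: "\<And>k i x y. dist y x < 1 / real (Suc (N k)) \<Longrightarrow> i \<le> k \<Longrightarrow>
      cmod (h i y - h i x) \<le> 1 / 4 ^ k" by metis
  \<comment> \<open>\<open>A k\<close> contains \<open>T 0, ..., T k\<close> and what is left of
    them after answers given at stages before \<open>k\<close>. It is finite although the strategies
    branch infinitely, so pointwise convergence is uniform on its positions.\<close>
  define A where "A = rec_nat {T 0} (\<lambda>k S. insert (T (Suc k)) (S \<union> child (N k) ` S))"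
  have A_Suc: "A (Suc k) = insert (T (Suc k)) (A k \<union> child (N k) ` A k)" for k
    by (simp add: A_def)
  have A_fin: "finite (A k)" for k
    by (induction k) (simp_all add: A_Suc, simp add: A_def)
  have A_mono: "A k \<subseteq> A (Suc k)" for k by (auto simp: A_Suc)
  have A_child: "child (N k) U \<in> A (Suc k)" if "U \<in> A k" for k U
    using that by (simp add: A_Suc)
  have TA: "T k \<in> A k" for k by (cases k) (simp add: A_def, simp add: A_Suc)
  have "\<exists>H. \<forall>n\<ge>H. \<forall>T\<in>A k. cmod (h n (position T) - f (position T)) \<le> 1 / 4 ^ k" for k
  proof -
    have "\<forall>\<^sub>F n in sequentially. \<forall>T\<in>A k. cmod (h n (position T) - f (position T)) < 1 / 4 ^ k"
      using A_fin tendstoD[OF lim, of "1 / 4 ^ k"]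
      by (intro eventually_ball_finite) (auto simp: dist_norm)
    then show ?thesis unfolding eventually_sequentially by (meson less_imp_le)
  qed
  then obtain H where H: "\<And>k n T. H k \<le> n \<Longrightarrow> T \<in> A k \<Longrightarrow>
      cmod (h n (position T) - f (position T)) \<le> 1 / 4 ^ k" by metis
  have "summable c"
    if r: "strict_mono r" "\<And>j. H (index_bound r j) \<le> r j"
      and B: "\<And>n x. cmod (\<Sum>i<n. c i * h (r i) x) \<le> B" "\<And>n. cmod (\<Sum>i<n. c i) \<le> B" for r c B
  proof (rule ccontr)
    assume "\<not> summable c"
    have r_Suc: "H (Suc (r j)) \<le> r (Suc j)" for j
      using r(2)[of "Suc j"] by (simp add: index_bound_def)
    \<comment> \<open>The term \<open>c j\<close> is included, so that \<open>\<sigma> j\<close> is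
      the factor of \<open>b (Suc j) - b j\<close> in the Abel summation.\<close>
    define \<sigma> where "\<sigma> j = (\<Sum>i<Suc j. c i)" for j
    have "\<not> convergent \<sigma>"
      using \<open>\<not> summable c\<close> convergent_Suc_iff[of "\<lambda>n. \<Sum>i<n. c i"]
      unfolding summable_iff_convergent \<sigma>_def by simp
    moreover have \<sigma>B: "cmod (\<sigma> j) \<le> B" for j unfolding \<sigma>_def by (rule B)
    ultimately obtain u v where uv: "u \<noteq> v"
      and u: "\<And>e p. e > 0 \<Longrightarrow> \<exists>j\<ge>p. cmod (\<sigma> j - u) \<le> e"
      and v: "\<And>e p. e > 0 \<Longrightarrow> \<exists>j\<ge>p. cmod (\<sigma> j - v) \<le> e"
      using bounded_divergent_cluster_points[of \<sigma> B] by blast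
    define s where "s j = (\<sigma> j - u) / (v - u)" for j
    define S where "S = (B + cmod u) / cmod (v - u)"
    have s: "cmod (s j) \<le> S" for j
      using norm_triangle_ineq4[of "\<sigma> j" u] \<sigma>B[of j]
      unfolding s_def S_def norm_divide by (intro divide_right_mono) auto
    have cluster: "\<exists>j\<ge>p. cmod (s j - of_bool \<beta>) \<le> 1 / 2 ^ p" for \<beta> p
    proof -
      define e where "e = cmod (v - u) / 2 ^ p"
      have "e > 0" using uv by (simp add: e_def)
      then have "\<exists>j\<ge>p. cmod (\<sigma> j - (if \<beta> then v else u)) \<le> e"
        using u[of e p] v[of e p] by (cases \<beta>) simp_all
      then obtain j where j: "j \<ge> p" "cmod (\<sigma> j - (if \<beta> then v else u)) \<le> e" by blast
      have "s j - of_bool \<beta> = (\<sigma> j - (if \<beta> then v else u)) / (v - u)"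
        using uv by (cases \<beta>) (simp_all add: s_def field_simps)
      then have "cmod (s j - of_bool \<beta>) \<le> e / cmod (v - u)"
        using j(2) by (simp only: norm_divide divide_right_mono norm_ge_zero)
      then show ?thesis using j(1) uv by (auto simp: e_def)
    qed
    define K where "K = (2 * (B * M + B) + 2 * cmod u * M) / cmod (v - u)"
    have upper: "cmod (\<Sum>i=p..<m. s i * (h (r (Suc i)) t - h (r i) t)) \<le> K" if "p \<le> m" for p m t
    proof -
      define b where "b i = h (r i) t" for i
      \<comment> \<open>Abel summation: the increments of \<open>P\<close> are
        \<open>\<sigma> i * (b (Suc i) - b i)\<close>, so their sums are bounded through the partial
        sums of \<open>c\<close> and of the series of functions.\<close>
      define P where "P i = \<sigma> i * b i - (\<Sum>j<Suc i. c j * b j)" for i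
      have P: "cmod (P i) \<le> B * M + B" for i
      proof -
        have "cmod (\<sigma> i * b i) \<le> B * M"
          unfolding norm_mult b_def using \<sigma>B bound order_trans[OF norm_ge_zero \<sigma>B]
          by (intro mult_mono) auto
        then show ?thesis
          using norm_triangle_ineq4[of "\<sigma> i * b i" "\<Sum>j<Suc i. c j * b j"] B(1)[where n = "Suc i" and x = t]
          unfolding P_def b_def by linarith
      qed
      have "\<sigma> i * (b (Suc i) - b i) = P (Suc i) - P i" for i
        by (simp add: P_def \<sigma>_def algebra_simps)
      then have 1: "(\<Sum>i=p..<m. \<sigma> i * (b (Suc i) - b i)) = P m - P p"
        using sum_Suc_diff'[OF that, of P] by simp
      have 2: "(\<Sum>i=p..<m. u * (b (Suc i) - b i)) = u * (b m - b p)"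
        unfolding sum_distrib_left[symmetric] using sum_Suc_diff'[OF that, of b] by simp
      have "(\<Sum>i=p..<m. s i * (b (Suc i) - b i))
          = (\<Sum>i=p..<m. (\<sigma> i * (b (Suc i) - b i) - u * (b (Suc i) - b i)) / (v - u))"
        by (intro sum.cong) (simp_all add: s_def left_diff_distrib)
      also have "\<dots> = (P m - P p - u * (b m - b p)) / (v - u)"
        unfolding sum_divide_distrib[symmetric] sum_subtractf 1 2 ..
      finally have eq: "(\<Sum>i=p..<m. s i * (b (Suc i) - b i)) = (P m - P p - u * (b m - b p)) / (v - u)" .
      have "cmod (u * (b m - b p)) \<le> cmod u * (2 * M)"
        unfolding norm_mult b_def
        using norm_triangle_ineq4[of "h (r m) t" "h (r p) t"] bound[of "r m" t] bound[of "r p" t]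
        by (intro mult_left_mono) auto
      then have "cmod (P m - P p - u * (b m - b p)) \<le> 2 * (B * M + B) + 2 * cmod u * M"
        using norm_triangle_ineq4[of "P m - P p" "u * (b m - b p)"] norm_triangle_ineq4[of "P m" "P p"]
          P[of m] P[of p] by simp
      then have "cmod (\<Sum>i=p..<m. s i * (b (Suc i) - b i)) \<le> K"
        unfolding eq norm_divide K_def by (rule divide_right_mono) simp
      then show ?thesis unfolding b_def .
    qed
    have S0: "0 \<le> S" using s[of 0] norm_ge_zero order_trans by blast
    have "real n \<le> K + (28 * S + 4 * M)" for n
    proof -
      \<comment> \<open>The play of \<open>T n\<close> starts at stage \<open>q = n\<close>, when
        this strategy is listed; the error allowance stays below \<open>28 * S + 4 * M\<close> for
        every \<open>n\<close>.\<close>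
      have TA': "T n \<in> A (Suc (r n))"
        using lift_Suc_mono_le[of A n "Suc (r n)", OF A_mono] TA[of n]
          strict_mono_imp_increasing[OF r(1), of n] by auto
      have "\<exists>m>n. \<exists>t. real n - (28 * S + 4 * M) / 2 ^ Suc n
            \<le> Re (a * (\<Sum>i=Suc n..<m. s i * (h (r (Suc i)) t - h (r i) t))) \<and>
          (\<forall>i\<le>Suc n. cmod (h (r i) t - h (r i) (position (T n))) \<le> 2 / 4 ^ Suc n)"
        by (rule strategy_play[where A = A and N = N and H = H and f = f])
          (fact A_mono A_child N H r(1) r_Suc fM s cluster a(1) T TA')+
      then obtain m t where "n < m"
        and lower: "real n - (28 * S + 4 * M) / 2 ^ Suc n
          \<le> Re (a * (\<Sum>i=Suc n..<m. s i * (h (r (Suc i)) t - h (r i) t)))"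
        by blast
      have "(28 * S + 4 * M) / 2 ^ Suc n \<le> (28 * S + 4 * M) / 1"
        using S0 M0 one_le_power[of "2 :: real" "Suc n"] by (intro divide_left_mono) auto
      then have "real n - (28 * S + 4 * M) \<le> real n - (28 * S + 4 * M) / 2 ^ Suc n"
        by (intro diff_left_mono) simp
      also note lower
      also have "Re (a * (\<Sum>i=Suc n..<m. s i * (h (r (Suc i)) t - h (r i) t))) \<le> K"
        using complex_Re_le_cmod[of "a * (\<Sum>i=Suc n..<m. s i * (h (r (Suc i)) t - h (r i) t))"]
          upper[of "Suc n" m t] \<open>n < m\<close> a(1) by (simp add: norm_mult)
      finally show ?thesis by simp
    qed
    then show False using reals_Archimedean2 not_le by blast
  qed
  then show ?thesis by blast
qed

section \<open>Choice of the subsequence\<close>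

theorem theorem1p8:
  fixes f :: "'a::metric_space \<Rightarrow> complex"
    and fs :: "nat \<Rightarrow> ('a \<Rightarrow>\<^sub>C complex)"
  assumes "compact (UNIV :: 'a set)"
    and "\<exists>M. \<forall>n x. cmod (apply_bcontfun (fs n) x) \<le> M"
    and "\<And>x. (\<lambda>n. apply_bcontfun (fs n) x) \<longlonglongrightarrow> f x"
    and "f \<notin> D_class"
  shows "\<exists>r :: nat \<Rightarrow> nat. strict_mono r \<and> strongly_summing (fs \<circ> r)"
proof -
  obtain M where M: "\<And>n x. cmod (apply_bcontfun (fs n) x) \<le> M" using assms(2) by blast
  have fM: "cmod (f x) \<le> M" for x
    using M by (intro LIMSEQ_le_const2[OF tendsto_norm[OF assms(3)]]) auto
  have "\<not> continuous_on UNIV f" using D_class_continuous[of f M] fM assms(4) by blast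
  then obtain H1 C where "0 \<le> C" and H1: "\<forall>r. strict_mono r \<and> (\<forall>j. H1 (index_bound r j) \<le> r j) \<longrightarrow>
      (\<forall>c n m. n \<le> m \<longrightarrow>
        cmod (\<Sum>i=n..<m. c i) \<le> C * norm (\<Sum>i<m. c i *\<^sub>C fs (r i)) \<and>
        norm (\<Sum>i<n. c i *\<^sub>C fs (r i)) \<le> C * norm (\<Sum>i<m. c i *\<^sub>C fs (r i)))"
    using sparse_subsequence_estimate[OF M assms(3)] by blast
  have "continuous_on UNIV (apply_bcontfun (fs n))" for n by simp
  then obtain H2 where H2: "\<forall>r. strict_mono r \<and> (\<forall>j. H2 (index_bound r j) \<le> r j) \<longrightarrow>
      (\<forall>c B. (\<forall>n x. cmod (\<Sum>i<n. c i * apply_bcontfun (fs (r i)) x) \<le> B) \<and>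
        (\<forall>n. cmod (\<Sum>i<n. c i) \<le> B) \<longrightarrow> summable c)"
    using sparse_subsequence_summing[of "\<lambda>n. apply_bcontfun (fs n)", OF assms(1) _ M assms(3,4)] by blast
  define H where "H k = max (H1 k) (H2 k)" for k
  \<comment> \<open>Each new index exceeds the previous one and reaches the threshold that
    \<open>H\<close> sets at \<open>Suc (r j)\<close>; the start \<open>H 0\<close> matches
    \<open>index_bound r 0 = 0\<close>.\<close>
  define r where "r = rec_nat (H 0) (\<lambda>_ k. max (Suc k) (H (Suc k)))"
  have r_Suc: "r (Suc j) = max (Suc (r j)) (H (Suc (r j)))" for j by (simp add: r_def)
  have r: "strict_mono r" unfolding strict_mono_Suc_iff by (simp add: r_Suc less_max_iff_disj)
  have "H (index_bound r j) \<le> r j" for j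
    by (cases j) (simp_all add: index_bound_def r_Suc, simp add: r_def)
  then have rH: "H1 (index_bound r j) \<le> r j" "H2 (index_bound r j) \<le> r j" for j
    unfolding H_def by (simp_all add: max.bounded_iff)
  have estimate: "cmod (\<Sum>i=n..<m. c i) \<le> C * norm (\<Sum>i<m. c i *\<^sub>C fs (r i))"
    "norm (\<Sum>i<n. c i *\<^sub>C fs (r i)) \<le> C * norm (\<Sum>i<m. c i *\<^sub>C fs (r i))" if "n \<le> m" for c n m
    using H1 r rH(1) that by blast+
  \<comment> \<open>With a single coefficient 1 at \<open>n\<close> the tail sum is 1, so
    \<open>1 \<le> C * norm (fs (r n))\<close>.\<close>
  have "fs (r n) \<noteq> 0" for n
    using estimate(1)[of n "Suc n" "\<lambda>i. if i = n then 1 else 0"] by (auto simp: if_distrib cong: if_cong)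
  then have "basic_sequence (fs \<circ> r)"
    using basic_sequence_Grunblum[OF \<open>0 \<le> C\<close>, of "fs \<circ> r"] estimate(2) by simp
  moreover have "weak_Cauchy (fs \<circ> r)"
    using M by (intro weak_Cauchy_pointwise_convergent[OF assms(1), of _ f M])
      (auto simp: o_def intro: LIMSEQ_subseq_LIMSEQ[OF assms(3) r, unfolded o_def])
  moreover have "summable c"
    if bdd: "bdd_above (range (\<lambda>n. norm (\<Sum>j<n. c j *\<^sub>C (fs \<circ> r) j)))" for c
  proof -
    obtain B where B: "\<And>n. norm (\<Sum>j<n. c j *\<^sub>C fs (r j)) \<le> B"
      using bdd unfolding bdd_above_def by auto
    have apply_sum: "apply_bcontfun (\<Sum>i<n. c i *\<^sub>C fs (r i)) x = (\<Sum>i<n. c i * apply_bcontfun (fs (r i)) x)" for n x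
      by (induction n) (simp_all add: plus_bcontfun.rep_eq)
    have "cmod (\<Sum>i<n. c i * apply_bcontfun (fs (r i)) x) \<le> max B (C * B)" for n x
      using norm_bounded[of "\<Sum>i<n. c i *\<^sub>C fs (r i)" x] B[of n] unfolding apply_sum by linarith
    \<comment> \<open>The tail starting at 0 is the whole partial sum of \<open>c\<close>, so it is
      bounded by \<open>C * B\<close>.\<close>
    moreover have "cmod (\<Sum>i<n. c i) \<le> max B (C * B)" for n
      using estimate(1)[of 0 n c] mult_left_mono[OF B[of n] \<open>0 \<le> C\<close>] by (simp add: lessThan_atLeast0)
    ultimately show ?thesis using H2 r rH(2) by blast
  qed
  ultimately show ?thesis using r unfolding strongly_summing_def by blast
qed

end
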